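(* Consider problem (P) and suppose Assumptions A, B and E hold. Let $\{x^t\}$ be generated by SCP$_{ls}$. Then $\{x^t\}$ converges to a minimizer $x^*$ of (P). If in addition $F$ is a KL function with exponent $\alpha\in[0,1)$, then: (i) if $\alpha\in[0,\frac12]$, there exist $c_0>0$, $Q_1\in(0,1)$ and $\underline t\in\mathbb N_+$ such that $\|x^t-x^*\|\le c_0Q_1^t$ for all $t>\underline t$; (ii) if $\alpha\in(\frac12,1)$, there exist $c_0>0$ and $\underline t\in\mathbb N_+$ such that $\|x^t-x^*\|\le c_0t^{-\frac{1-\alpha}{2\alpha-1}}$ for all $t>\underline t$.
   Context: Problem (P): $\min_{x\in\mathbb R^n}F(x):=f(x)+P_1(x)-P_2(x)+\delta_{\{g\le 0\}}(x)$, where $f:\mathbb R^n\to\mathbb R$ is continuously differentiable, $P_1,P_2:\mathbb R^n\to\mathbb R$ are convex and continuous, $g=(g_1,\dots,g_m):\mathbb R^n\to\mathbb R^m$ is continuous with $\{x:g(x)\le0\}\neq\emptyset$ (componentwise inequalities), $\delta_C$ the indicator function of $C$; $\partial$ is the limiting subdifferential. Assumption A: (i) $\nabla f$ is Lipschitz with modulus $L_f$; (ii) each $g_i$ is differentiable with $\nabla g_i$ Lipschitz with modulus $L_{g_i}$; (iii) $F$ is level-bounded. Assumption B (MFCQ): each $g_i$ is continuously differentiable and for every $x$ with $g(x)\le0$ there is $d$ with $\langle\nabla g_i(x),d\rangle<0$ for all $i\in I(x):=\{j:g_j(x)=0\}$. Assumption E: $P_2\equiv0$ and $f,g_1,\dots,g_m$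 are convex. KL property with exponent $\alpha\in[0,1)$: a proper closed $h$ has it at $\hat x\in{\rm dom}\,\partial h$ if there exist $a\in(0,\infty]$, a neighborhood $V$ of $\hat x$ and $a_0>0$ such that $a_0(1-\alpha)(h(x)-h(\hat x))^{-\alpha}\,{\rm dist}(0,\partial h(x))\ge1$ for all $x\in V$ with $h(\hat x)<h(x)<h(\hat x)+a$; $h$ is a KL function with exponent $\alpha$ if this holds at every point of ${\rm dom}\,\partial h$. $\bar G(x,y,w)\in\mathbb R^m$ has components $\bar G_i(x,y,w)=g_i(y)+\langle\nabla g_i(y),x-y\rangle+\frac{w_i}{2}\|x-y\|^2$. Algorithm SCP$_{ls}$: fix $c>0$, $0<\underline L<\bar L$, $\tau>1$ and $x^0$ with $g(x^0)\le0$. For $t=0,1,2,\dots$: (1) pick any $\xi^t\in\partial P_2(x^t)$; (2) choose $L_f^{t,0}\in[\underline L,\bar L]$, $L_g^{t,0}\in[\underline L,\bar L]^m$ arbitrarily, set $\tilde L_f=L_f^{t,0}$, $\tilde L_g=L_g^{t,0}$; (3) compute $\tilde x$ solving: minimize $\langle\nabla f(x^t)-\xi^t,x-x^t\rangle+\frac{\tilde L_f}{2}\|x-x^t\|^2+P_1(x)$ subject to $\bar G(x,x^t,\tilde L_g)\le0$. If $g(\tilde x)\le0$ and $F(\tilde x)\le F(x^t)-\frac c2\|\tilde x-x^t\|^2$, set $x^{t+1}=\tilde x$, $L_f^t=\tilde L_f$, $L_g^t=\tilde L_g$ and go to iteration $t+1$; otherwise, if $g(\tilde x)\not\le0$ replace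 $\tilde L_g$ by $\tau\tilde L_g$, while if $g(\tilde x)\le0$ but the decrease inequality fails replace $\tilde L_f$ by $\tau\tilde L_f$, and repeat step (3). *)

theory Defs
  imports "HOL-Analysis.Analysis"
begin

definition frechet_subdiff :: "('a::real_inner \<Rightarrow> ereal) \<Rightarrow> 'a \<Rightarrow> 'a set" where
  "frechet_subdiff h x =
     {v. h x \<noteq> \<infinity> \<and> h x \<noteq> -\<infinity> \<and>
         (\<forall>e>0. \<exists>d>0. \<forall>y. norm (y - x) < d \<longrightarrow>
             h x + ereal (v \<bullet> (y - x) - e * norm (y - x)) \<le> h y)}"

definition limiting_subdiff :: "('a::real_inner \<Rightarrow> ereal) \<Rightarrow> 'a \<Rightarrow> 'a set" where
  "limiting_subdiff h x =
     {v. \<exists>xs vs. xs \<longlonglongrightarrow> x \<and> (\<lambda>k. h (xs k)) \<longlonglongrightarrow> h x \<and>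
          (\<forall>k. vs k \<in> frechet_subdiff h (xs k)) \<and> vs \<longlonglongrightarrow> v}"

text \<open>KL property with exponent alpha at a point; dist(0, empty set) = +infinity convention.\<close>
definition KL_at :: "('a::real_inner \<Rightarrow> ereal) \<Rightarrow> real \<Rightarrow> 'a \<Rightarrow> bool" where
  "KL_at h \<alpha> xh \<longleftrightarrow>
     (\<exists>a::ereal. a > 0 \<and> (\<exists>V. open V \<and> xh \<in> V \<and> (\<exists>a0>0.
        \<forall>x\<in>V. h xh < h x \<and> h x < h xh + a \<longrightarrow>
          limiting_subdiff h x \<noteq> {} \<longrightarrow>
          a0 * (1 - \<alpha>) * (real_of_ereal (h x - h xh)) powr (- \<alpha>)
             * infdist 0 (limiting_subdiff h x) \<ge> 1)))"

definition KL_function :: "('a::real_inner \<Rightarrow> ereal) \<Rightarrow> real \<Rightarrow> bool" where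
  "KL_function h \<alpha> \<longleftrightarrow> (\<forall>xh. limiting_subdiff h xh \<noteq> {} \<longrightarrow> KL_at h \<alpha> xh)"

definition Fext :: "('a \<Rightarrow> real) \<Rightarrow> ('a \<Rightarrow> real) \<Rightarrow> ('a \<Rightarrow> real) \<Rightarrow> (nat \<Rightarrow> 'a \<Rightarrow> real) \<Rightarrow> nat
                    \<Rightarrow> 'a \<Rightarrow> ereal" where
  "Fext f P1 P2 g m x = (if (\<forall>i<m. g i x \<le> 0) then ereal (f x + P1 x - P2 x) else \<infinity>)"

definition subprob_sol :: "('a::real_inner \<Rightarrow> 'a) \<Rightarrow> ('a \<Rightarrow> real) \<Rightarrow> (nat \<Rightarrow> 'a \<Rightarrow> real)
      \<Rightarrow> (nat \<Rightarrow> 'a \<Rightarrow> 'a) \<Rightarrow> nat \<Rightarrow> 'a \<Rightarrow> 'a \<Rightarrow> real \<Rightarrow> (nat \<Rightarrow> real) \<Rightarrow> 'a \<Rightarrow> bool" where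
  "subprob_sol gradf P1 g gradg m xt \<xi> Lf w z \<longleftrightarrow>
     (\<forall>i<m. g i xt + gradg i xt \<bullet> (z - xt) + w i / 2 * (norm (z - xt))\<^sup>2 \<le> 0) \<and>
     (\<forall>y. (\<forall>i<m. g i xt + gradg i xt \<bullet> (y - xt) + w i / 2 * (norm (y - xt))\<^sup>2 \<le> 0) \<longrightarrow>
        (gradf xt - \<xi>) \<bullet> (z - xt) + Lf / 2 * (norm (z - xt))\<^sup>2 + P1 z
          \<le> (gradf xt - \<xi>) \<bullet> (y - xt) + Lf / 2 * (norm (y - xt))\<^sup>2 + P1 y)"

text \<open>x is a sequence generated by SCP_ls (for some admissible choices of the subgradients,
  initial step parameters and subproblem minimizers); the inner line search at iteration t
  performs trials y 0, ..., y K with exponents kf j, kg j of tau, accepting y K.\<close>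
definition SCP_ls :: "('a::real_inner \<Rightarrow> real) \<Rightarrow> ('a \<Rightarrow> 'a) \<Rightarrow> ('a \<Rightarrow> real) \<Rightarrow> ('a \<Rightarrow> real)
      \<Rightarrow> (nat \<Rightarrow> 'a \<Rightarrow> real) \<Rightarrow> (nat \<Rightarrow> 'a \<Rightarrow> 'a) \<Rightarrow> nat \<Rightarrow> real \<Rightarrow> real \<Rightarrow> real \<Rightarrow> real
      \<Rightarrow> (nat \<Rightarrow> 'a) \<Rightarrow> bool" where
  "SCP_ls f gradf P1 P2 g gradg m c Ll Lu \<tau> x \<longleftrightarrow>
     (\<forall>i<m. g i (x 0) \<le> 0) \<and>
     (\<forall>t. \<exists>\<xi> \<in> limiting_subdiff (\<lambda>z. ereal (P2 z)) (x t).
        \<exists>Lf0 Lg0. Ll \<le> Lf0 \<and> Lf0 \<le> Lu \<and> (\<forall>i<m. Ll \<le> Lg0 i \<and> Lg0 i \<le> Lu) \<and>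
        (\<exists>K::nat. \<exists>kf kg :: nat \<Rightarrow> nat. \<exists>y :: nat \<Rightarrow> 'a.
           kf 0 = 0 \<and> kg 0 = 0 \<and>
           (\<forall>j\<le>K. subprob_sol gradf P1 g gradg m (x t) \<xi> (\<tau> ^ kf j * Lf0)
                      (\<lambda>i. \<tau> ^ kg j * Lg0 i) (y j)) \<and>
           (\<forall>j<K. if (\<forall>i<m. g i (y j) \<le> 0)
                   then (f (y j) + P1 (y j) - P2 (y j)
                          > f (x t) + P1 (x t) - P2 (x t) - c / 2 * (norm (y j - x t))\<^sup>2
                         \<and> kf (Suc j) = Suc (kf j) \<and> kg (Suc j) = kg j)
                   else (kf (Suc j) = kf j \<and> kg (Suc j) = Suc (kg j))) \<and>
           (\<forall>i<m. g i (y K) \<le> 0) \<and>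
           f (y K) + P1 (y K) - P2 (y K)
              \<le> f (x t) + P1 (x t) - P2 (x t) - c / 2 * (norm (y K - x t))\<^sup>2 \<and>
           x (Suc t) = y K))"

end

theory Submission
  imports Defs
begin

text \<open>In the convex setting the line search keeps all step parameters bounded, and MFCQ yields a
  Slater point, which makes the subproblem multipliers uniformly bounded. Strong convexity of the
  Lagrangian then gives, for every feasible \<open>z\<close>, an inequality
  \<open>F(x\<^sup>t\<^sup>+\<^sup>1) - F(z) \<le> A\<^sub>t/2 (|z - x\<^sup>t|\<^sup>2 - |z - x\<^sup>t\<^sup>+\<^sup>1|\<^sup>2) + L |x\<^sup>t\<^sup>+\<^sup>1 - x\<^sup>t|\<^sup>2\<close> with \<open>A\<^sub>t\<close> bounded above and away
  from 0. With \<open>z\<close> a minimizer and the sufficient decrease, \<open>|z - x\<^sup>t|\<^sup>2 + \<kappa> F(x\<^sup>t)\<close> is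
  nonincreasing, so the iterates converge to a minimizer. The KL inequality implies that the distance
  from \<open>x\<^sup>t\<close> to the minimizers is at most \<open>K r\<^sub>t powr (1 - \<alpha>)\<close>, where \<open>r\<^sub>t = F(x\<^sup>t) - min F\<close>. Taking
  for \<open>z\<close> a minimizer that close to \<open>x\<^sup>t\<close> turns the inequality into
  \<open>r\<^sub>t - r\<^sub>t\<^sub>+\<^sub>1 \<ge> \<theta> r\<^sub>t powr (2 max(\<alpha>, 1/2))\<close>, from which both rates follow.\<close>

section \<open>Convexity and a scalar Lagrange multiplier\<close>

text \<open>Closes the first-order arguments below: an optimality test along a segment is divided by
  the step \<open>s\<close>, and then \<open>s\<close> tends to 0.\<close>

lemma le_if_le_add_small_mult:
  fixes a b c :: real
  assumes "\<And>s. 0 < s \<Longrightarrow> s < 1 \<Longrightarrow> a \<le> b + s * c"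
  shows "a \<le> b"
proof (rule tendsto_lowerbound)
  show "((\<lambda>s. b + s * c) \<longlongrightarrow> b) (at_right 0)"
    by (auto intro!: tendsto_eq_intros)
  show "\<forall>\<^sub>F s in at_right 0. a \<le> b + s * c"
    using assms by (auto simp: eventually_at_right_field intro: exI[of _ 1])
qed simp

lemma norm_convex_comb_sq:
  fixes a b :: "'a::real_inner"
  shows "(norm ((1 - s) *\<^sub>R a + s *\<^sub>R b))\<^sup>2 =
    (1 - s) * (norm a)\<^sup>2 + s * (norm b)\<^sup>2 - s * (1 - s) * (norm (a - b))\<^sup>2"
  unfolding power2_norm_eq_inner
  by (simp add: inner_left_distrib inner_right_distrib inner_diff_left inner_diff_right
      inner_commute[of b a] algebra_simps power2_eq_square)

text \<open>Restriction to the line through \<open>x\<close> and \<open>y\<close> leaves the tangent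
  inequality for a convex function of one real variable.\<close>

lemma convex_on_above_gradient:
  fixes f :: "'a::real_inner \<Rightarrow> real"
  assumes conv: "convex_on UNIV f"
    and der: "(f has_derivative (\<lambda>h. v \<bullet> h)) (at x)"
  shows "f x + v \<bullet> (y - x) \<le> f y"
proof -
  define l where "l s = x + s *\<^sub>R (y - x)" for s :: real
  have l: "l ((1 - u) *\<^sub>R a + u *\<^sub>R b) = (1 - u) *\<^sub>R l a + u *\<^sub>R l b" for u a b
    by (simp add: l_def algebra_simps)
  have "convex_on UNIV (f \<circ> l)"
  proof (rule convex_onI)
    show "(f \<circ> l) ((1 - t) *\<^sub>R a + t *\<^sub>R b) \<le> (1 - t) * (f \<circ> l) a + t * (f \<circ> l) b"
      if "0 < t" "t < 1" for t a b
      using convex_onD[OF conv, of t "l a" "l b"] that l[of t a b] by simp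
  qed simp
  moreover have "(f \<circ> l has_derivative (\<lambda>s. v \<bullet> (s *\<^sub>R (y - x)))) (at 0)"
    unfolding o_def
  proof (rule has_derivative_compose[where g = f])
    show "(l has_derivative (\<lambda>s. s *\<^sub>R (y - x))) (at 0)"
      unfolding l_def by (auto intro!: derivative_eq_intros)
    show "(f has_derivative (\<bullet>) v) (at (l 0))" using der by (simp add: l_def)
  qed
  then have "(f \<circ> l has_real_derivative (v \<bullet> (y - x))) (at 0)"
    by (rule has_derivative_imp_has_field_derivative) simp
  ultimately have "(f \<circ> l) 1 - (f \<circ> l) 0 \<ge> (v \<bullet> (y - x)) * (1 - 0)"
    by (intro convex_on_imp_above_tangent[where A = UNIV]) (simp_all add: o_def)
  then show ?thesis by (simp add: l_def)
qed

text \<open>Convexity replaces integration along the segment: the tangent inequality is taken at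
  \<open>y\<close>, and the Lipschitz bound exchanges \<open>gradf y\<close> for
  \<open>gradf x\<close>. Having \<open>L\<close> instead of the usual \<open>L / 2\<close> only
  affects constants later on.\<close>

lemma convex_descent:
  fixes f :: "'a::real_inner \<Rightarrow> real"
  assumes conv: "convex_on UNIV f"
    and der: "\<And>z. (f has_derivative (\<lambda>h. gradf z \<bullet> h)) (at z)"
    and lip: "\<And>y z. norm (gradf y - gradf z) \<le> L * norm (y - z)"
  shows "f y \<le> f x + gradf x \<bullet> (y - x) + L * (norm (y - x))\<^sup>2"
proof -
  have "f y + gradf y \<bullet> (x - y) \<le> f x" by (rule convex_on_above_gradient[OF conv der])
  moreover have "(gradf y - gradf x) \<bullet> (y - x) \<le> norm (gradf y - gradf x) * norm (y - x)"
    by (rule norm_cauchy_schwarz)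
  moreover have "\<dots> \<le> L * norm (y - x) * norm (y - x)"
    by (rule mult_right_mono[OF lip]) simp
  ultimately show ?thesis
    by (simp add: inner_diff_left inner_diff_right power2_eq_square algebra_simps)
qed

text \<open>Points of \<open>T\<close> pair an objective excess with a constraint level. The
  multiplier is the supremum of 0 and the slopes \<open>- p / r\<close> with \<open>r > 0\<close>: a
  segment from such a point to one of negative level crosses the axis \<open>r = 0\<close> at
  nonnegative height, which orders the slopes on the two sides. The Slater point bounds the
  supremum.\<close>

lemma planar_multiplier:
  fixes T :: "(real \<times> real) set"
  assumes "convex T"
    and nonneg: "\<And>p r. (p, r) \<in> T \<Longrightarrow> r \<le> 0 \<Longrightarrow> 0 \<le> p"
    and slater: "(p0, - \<sigma>) \<in> T" "0 < \<sigma>"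
  obtains \<mu> where "0 \<le> \<mu>" "\<mu> \<le> p0 / \<sigma>" "\<And>p r. (p, r) \<in> T \<Longrightarrow> 0 \<le> p + \<mu> * r"
proof -
  have slopes: "- p / r \<le> q / s" if "(p, r) \<in> T" "0 < r" "(q, - s) \<in> T" "0 < s" for p r q s
  proof -
    \<comment> \<open>These weights place the combination on the axis \<open>r = 0\<close>, where
      \<open>nonneg\<close> applies.\<close>
    have "s / (r + s) + r / (r + s) = 1"
      using that by (simp add: add_divide_distrib[symmetric])
    have "(s / (r + s)) *\<^sub>R (p, r) + (r / (r + s)) *\<^sub>R (q, - s) \<in> T"
      using that \<open>_ = 1\<close> by (intro convexD[OF \<open>convex T\<close>]) auto
    then have "(s / (r + s) * p + r / (r + s) * q, 0) \<in> T"
      by (simp add: mult.commute)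
    then have "0 \<le> s / (r + s) * p + r / (r + s) * q"
      by (rule nonneg) simp
    also have "\<dots> = (s * p + r * q) / (r + s)" by (simp add: add_divide_distrib)
    finally have "0 \<le> s * p + r * q" using that by (simp add: zero_le_divide_iff)
    then show ?thesis using that by (simp add: field_simps)
  qed
  \<comment> \<open>The inserted 0 makes the set nonempty and its supremum nonnegative even if no
    point has positive level.\<close>
  define B where "B = insert 0 {- p / r | p r. (p, r) \<in> T \<and> 0 < r}"
  have ub: "b \<le> q / s" if "b \<in> B" "(q, - s) \<in> T" "0 < s" for b q s
    using that slopes nonneg[of q "- s"] by (auto simp: B_def)
  have bdd: "bdd_above B" using ub[OF _ slater] by (auto simp: bdd_above_def)
  show thesis
  proof
    show "0 \<le> Sup B" by (rule cSup_upper[OF _ bdd]) (simp add: B_def)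
    show "Sup B \<le> p0 / \<sigma>" by (rule cSup_least) (use ub[OF _ slater] in \<open>auto simp: B_def\<close>)
    fix p r assume pr: "(p, r) \<in> T"
    consider "r < 0" | "r = 0" | "0 < r" by linarith
    then show "0 \<le> p + Sup B * r"
    proof cases
      case 1
      have "Sup B \<le> p / - r"
        by (rule cSup_least) (use ub[of _ p "- r"] pr 1 in \<open>auto simp: B_def\<close>)
      then show ?thesis using 1 by (simp add: field_simps)
    next
      case 2
      then show ?thesis using nonneg[OF pr] by simp
    next
      case 3
      have "- p / r \<le> Sup B" by (rule cSup_upper[OF _ bdd]) (use pr 3 in \<open>auto simp: B_def\<close>)
      then show ?thesis using 3 by (simp add: field_simps)
    qed
  qed
qed

text \<open>All constraints are measured by one common level, so a single multiplier for the planar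
  set \<open>T\<close> suffices. Testing it along the segment from \<open>xn\<close> to
  \<open>z\<close> keeps the curvature: the objective contributes \<open>\<kappa>\<close>, and the
  constraints contribute modulus 1 weighted by \<open>\<mu>\<close>.\<close>

lemma strongly_convex_multiplier:
  fixes \<phi> :: "'a::real_inner \<Rightarrow> real" and G :: "'i \<Rightarrow> 'a \<Rightarrow> real"
  assumes \<phi>: "\<And>s u v. 0 \<le> s \<Longrightarrow> s \<le> 1 \<Longrightarrow> \<phi> ((1 - s) *\<^sub>R u + s *\<^sub>R v)
      \<le> (1 - s) * \<phi> u + s * \<phi> v - s * (1 - s) * (\<kappa> / 2 * (norm (u - v))\<^sup>2)"
    and G: "\<And>i s u v. i \<in> I \<Longrightarrow> 0 \<le> s \<Longrightarrow> s \<le> 1 \<Longrightarrow> G i ((1 - s) *\<^sub>R u + s *\<^sub>R v)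
      \<le> (1 - s) * G i u + s * G i v - s * (1 - s) * ((norm (u - v))\<^sup>2 / 2)"
    and "0 \<le> \<kappa>"
    and feas: "\<And>i. i \<in> I \<Longrightarrow> G i xn \<le> 0"
    and opt: "\<And>y. (\<And>i. i \<in> I \<Longrightarrow> G i y \<le> 0) \<Longrightarrow> \<phi> xn \<le> \<phi> y"
    and slater: "\<And>i. i \<in> I \<Longrightarrow> G i ys \<le> - \<sigma>" and "0 < \<sigma>"
  obtains \<mu> where "0 \<le> \<mu>" "\<mu> \<le> (\<phi> ys - \<phi> xn) / \<sigma>"
    "\<And>z r. (\<And>i. i \<in> I \<Longrightarrow> G i z \<le> r) \<Longrightarrow>
       \<phi> xn + (\<kappa> + \<mu>) / 2 * (norm (z - xn))\<^sup>2 \<le> \<phi> z + \<mu> * r"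
proof -
  define T where "T = {(p, r). \<exists>y. \<phi> y - \<phi> xn \<le> p \<and> (\<forall>i\<in>I. G i y \<le> r)}"
  have "convex T"
    unfolding convex_alt
  proof (safe)
    fix p r q s and t :: real
    assume "(p, r) \<in> T" "(q, s) \<in> T" and t: "0 \<le> t" "t \<le> 1"
    then obtain u v where u: "\<phi> u - \<phi> xn \<le> p" "\<And>i. i \<in> I \<Longrightarrow> G i u \<le> r"
      and v: "\<phi> v - \<phi> xn \<le> q" "\<And>i. i \<in> I \<Longrightarrow> G i v \<le> s"
      by (auto simp: T_def)
    let ?y = "(1 - t) *\<^sub>R u + t *\<^sub>R v"
    have "0 \<le> t * (1 - t) * (\<kappa> / 2 * (norm (u - v))\<^sup>2)" "0 \<le> t * (1 - t) * ((norm (u - v))\<^sup>2 / 2)"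
      using t \<open>0 \<le> \<kappa>\<close> by auto
    then have "\<phi> ?y \<le> (1 - t) * \<phi> u + t * \<phi> v"
      and 1: "\<And>i. i \<in> I \<Longrightarrow> G i ?y \<le> (1 - t) * G i u + t * G i v"
      using \<phi>[OF t, of u v] G[OF _ t, of _ u v] by force+
    moreover have "(1 - t) * (\<phi> u - \<phi> xn) + t * (\<phi> v - \<phi> xn) \<le> (1 - t) * p + t * q"
      using u v t by (intro add_mono mult_left_mono) auto
    ultimately have "\<phi> ?y - \<phi> xn \<le> (1 - t) * p + t * q" by (simp add: algebra_simps)
    moreover have "G i ?y \<le> (1 - t) * r + t * s" if "i \<in> I" for i
    proof -
      have "(1 - t) * G i u + t * G i v \<le> (1 - t) * r + t * s"
        using u v t that by (intro add_mono mult_left_mono) auto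
      then show ?thesis using 1[OF that] by linarith
    qed
    ultimately have "((1 - t) * p + t * q, (1 - t) * r + t * s) \<in> T"
      unfolding T_def by blast
    then show "(1 - t) *\<^sub>R (p, r) + t *\<^sub>R (q, s) \<in> T" by simp
  qed
  moreover have "0 \<le> p" if pr: "(p, r) \<in> T" "r \<le> 0" for p r
  proof -
    obtain y where y: "\<phi> y - \<phi> xn \<le> p" "\<And>i. i \<in> I \<Longrightarrow> G i y \<le> r"
      using pr by (auto simp: T_def)
    then show ?thesis using opt[of y] \<open>r \<le> 0\<close> by fastforce
  qed
  moreover have "(\<phi> ys - \<phi> xn, - \<sigma>) \<in> T" using slater by (auto simp: T_def)
  ultimately obtain \<mu> where \<mu>: "0 \<le> \<mu>" "\<mu> \<le> (\<phi> ys - \<phi> xn) / \<sigma>"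
    and lag: "\<And>p r. (p, r) \<in> T \<Longrightarrow> 0 \<le> p + \<mu> * r"
    using planar_multiplier \<open>0 < \<sigma>\<close> by blast
  show thesis
  proof (rule that[OF \<mu>])
    fix z r assume z: "\<And>i. i \<in> I \<Longrightarrow> G i z \<le> r"
    let ?d = "(norm (xn - z))\<^sup>2"
    \<comment> \<open>The inequality at parameter \<open>s\<close> is divided by \<open>s\<close>;
      the remaining factor \<open>1 - s\<close> of the curvature is written as 1 plus an error that
      vanishes with \<open>s\<close>.\<close>
    have "\<phi> xn + (\<kappa> + \<mu>) / 2 * ?d \<le> \<phi> z + \<mu> * r + s * ((\<kappa> + \<mu>) / 2 * ?d)"
      if s: "0 < s" "s < 1" for s
    proof -
      let ?y = "(1 - s) *\<^sub>R xn + s *\<^sub>R z"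
      have "G i ?y \<le> s * r - s * (1 - s) * (?d / 2)" if "i \<in> I" for i
      proof -
        have "(1 - s) * G i xn \<le> 0" "s * G i z \<le> s * r"
          using s feas[OF that] z[OF that] by (auto simp: mult_nonneg_nonpos)
        then show ?thesis using G[OF that, of s xn z] s by linarith
      qed
      then have "(\<phi> ?y - \<phi> xn, s * r - s * (1 - s) * (?d / 2)) \<in> T" by (auto simp: T_def)
      from lag[OF this] have "0 \<le> \<phi> ?y - \<phi> xn + \<mu> * (s * r - s * (1 - s) * (?d / 2))" .
      moreover have "\<phi> ?y \<le> (1 - s) * \<phi> xn + s * \<phi> z - s * (1 - s) * (\<kappa> / 2 * ?d)"
        using \<phi>[of s xn z] s by simp
      ultimately have "s * (\<phi> xn + (\<kappa> + \<mu>) / 2 * ?d) \<le> s * (\<phi> z + \<mu> * r + s * ((\<kappa> + \<mu>) / 2 * ?d))"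
        by (simp add: field_simps)
      then show ?thesis using s by simp
    qed
    then have "\<phi> xn + (\<kappa> + \<mu>) / 2 * ?d \<le> \<phi> z + \<mu> * r" by (rule le_if_le_add_small_mult)
    then show "\<phi> xn + (\<kappa> + \<mu>) / 2 * (norm (z - xn))\<^sup>2 \<le> \<phi> z + \<mu> * r"
      by (simp add: norm_minus_commute)
  qed
qed

text \<open>The modulus \<open>A\<close> is \<open>Lf + \<mu>\<close>. A Slater point of the
  subproblem itself, reached by a short move from \<open>xt\<close> towards \<open>zs\<close>,
  bounds \<open>\<mu>\<close> in terms of uniform data. The term with \<open>L\<close> is the price
  of replacing the linearization of \<open>f\<close> by its value at \<open>xn\<close>.\<close>

lemma subprob_three_point:
  fixes f P1 :: "'a::real_inner \<Rightarrow> real" and gradf :: "'a \<Rightarrow> 'a"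
    and g :: "nat \<Rightarrow> 'a \<Rightarrow> real" and gradg :: "nat \<Rightarrow> 'a \<Rightarrow> 'a"
  assumes f_conv: "convex_on UNIV f"
    and f_grad: "\<And>z. (f has_derivative (\<lambda>h. gradf z \<bullet> h)) (at z)"
    and f_lip: "\<And>y z. norm (gradf y - gradf z) \<le> L * norm (y - z)" and "0 \<le> L"
    and P1: "convex_on UNIV P1"
    and g_conv: "\<And>i. i < m \<Longrightarrow> convex_on UNIV (g i)"
    and g_grad: "\<And>i z. i < m \<Longrightarrow> (g i has_derivative (\<lambda>h. gradg i z \<bullet> h)) (at z)"
    and sol: "subprob_sol gradf P1 g gradg m xt 0 Lf w xn"
    and Lf: "0 < Ll" "Ll \<le> Lf" "Lf \<le> M" and w: "\<And>i. i < m \<Longrightarrow> Ll \<le> w i \<and> w i \<le> M"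
    and xt: "\<And>i. i < m \<Longrightarrow> g i xt \<le> 0"
    and slater: "\<And>i. i < m \<Longrightarrow> g i zs \<le> - \<delta>" "0 < \<delta>"
    and D: "norm (zs - xt) \<le> D" "norm (xn - xt) \<le> D" "0 < D"
    and U: "f xt + P1 xt \<le> U" "f zs + P1 zs \<le> U" and lo: "lo \<le> f xn + P1 xn"
    and \<sigma>: "\<sigma> = min 1 (\<delta> / (M * D\<^sup>2)) * \<delta> / (2 * M)"
  shows "\<exists>A. Ll \<le> A \<and> A \<le> M + (U + M / 2 * D\<^sup>2 - lo + L * D\<^sup>2) / \<sigma> \<and>
    (\<forall>z. (\<forall>i<m. g i z \<le> 0) \<longrightarrow> f xn + P1 xn - (f z + P1 z)
      \<le> A / 2 * ((norm (z - xt))\<^sup>2 - (norm (z - xn))\<^sup>2) + L * (norm (xn - xt))\<^sup>2)"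
proof -
  define lin where "lin i z = g i xt + gradg i xt \<bullet> (z - xt)" for i z
  \<comment> \<open>Dividing each constraint by its own w i makes all curvatures equal, so that a single
    multiplier for the worst constraint suffices.\<close>
  define G where "G i z = lin i z / w i + (norm (z - xt))\<^sup>2 / 2" for i z
  define \<phi> where "\<phi> z = gradf xt \<bullet> (z - xt) + Lf / 2 * (norm (z - xt))\<^sup>2 + P1 z" for z
  have M: "0 < M" using Lf by linarith
  have wpos: "0 < w i" if "i < m" for i using w[OF that] Lf by linarith
  have shift: "(1 - s) *\<^sub>R u + s *\<^sub>R v - xt = (1 - s) *\<^sub>R (u - xt) + s *\<^sub>R (v - xt)" for s u v
    by (simp add: algebra_simps)
  have sq: "(norm ((1 - s) *\<^sub>R u + s *\<^sub>R v - xt))\<^sup>2 =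
    (1 - s) * (norm (u - xt))\<^sup>2 + s * (norm (v - xt))\<^sup>2 - s * (1 - s) * (norm (u - v))\<^sup>2" for s u v
    unfolding shift norm_convex_comb_sq by simp
  have lin_comb: "lin i ((1 - s) *\<^sub>R u + s *\<^sub>R v) = (1 - s) * lin i u + s * lin i v" for i s u v
    unfolding lin_def shift by (simp add: inner_right_distrib algebra_simps)
  have G_comb: "G i ((1 - s) *\<^sub>R u + s *\<^sub>R v) =
      (1 - s) * G i u + s * G i v - s * (1 - s) * ((norm (u - v))\<^sup>2 / 2)" for i s u v
    unfolding G_def lin_comb sq by (simp add: add_divide_distrib algebra_simps diff_divide_distrib)
  have \<phi>_comb: "\<phi> ((1 - s) *\<^sub>R u + s *\<^sub>R v)
      \<le> (1 - s) * \<phi> u + s * \<phi> v - s * (1 - s) * (Lf / 2 * (norm (u - v))\<^sup>2)"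
    if "0 \<le> s" "s \<le> 1" for s u v
  proof -
    have "gradf xt \<bullet> ((1 - s) *\<^sub>R u + s *\<^sub>R v - xt) =
        (1 - s) * (gradf xt \<bullet> (u - xt)) + s * (gradf xt \<bullet> (v - xt))"
      unfolding shift by (simp add: inner_right_distrib)
    then show ?thesis
      using convex_onD[OF P1 that, of u v] unfolding \<phi>_def sq
      by (simp add: algebra_simps add_divide_distrib diff_divide_distrib)
  qed
  have G_iff: "G i z \<le> 0 \<longleftrightarrow> g i xt + gradg i xt \<bullet> (z - xt) + w i / 2 * (norm (z - xt))\<^sup>2 \<le> 0"
    if "i < m" for i z
    using wpos[OF that] by (simp add: G_def lin_def field_simps)
  have lin_le: "lin i z \<le> g i z" if "i < m" for i z
    unfolding lin_def by (rule convex_on_above_gradient[OF g_conv[OF that] g_grad[OF that]])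

  \<comment> \<open>Along the segment the linear parts fall to \<open>- s * \<delta>\<close> or
    lower, while the quadratic ones are at most \<open>M * s\<^sup>2 * D\<^sup>2 / 2\<close>; this
    \<open>s\<close> lets them consume at most half of that gain. The further factor
    \<open>1 / M\<close> in \<open>\<sigma>\<close> comes from dividing by
    \<open>w i\<close>.\<close>
  define s where "s = min 1 (\<delta> / (M * D\<^sup>2))"
  define ys where "ys = (1 - s) *\<^sub>R xt + s *\<^sub>R zs"
  have s: "0 < s" "s \<le> 1" "s * (M * D\<^sup>2) \<le> \<delta>"
    using M D slater by (auto simp: s_def min_def field_simps)
  have D2: "(norm (zs - xt))\<^sup>2 \<le> D\<^sup>2" "(norm (xn - xt))\<^sup>2 \<le> D\<^sup>2"
    using D by (auto intro!: power_mono)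
  have \<sigma>': "\<sigma> = s * \<delta> / (2 * M)" by (simp add: \<sigma> s_def)
  have "0 < \<sigma>" unfolding \<sigma>' using s M slater by simp
  have G_ys: "G i ys \<le> - \<sigma>" if "i < m" for i
  proof -
    have "lin i ys = (1 - s) * g i xt + s * lin i zs"
      unfolding ys_def lin_comb by (simp add: lin_def)
    also have "\<dots> \<le> 0 + s * (- \<delta>)"
      using s xt[OF that] order_trans[OF lin_le[OF that] slater(1)[OF that]]
      by (intro add_mono mult_left_mono) (auto simp: mult_nonneg_nonpos)
    finally have 1: "lin i ys \<le> - (s * \<delta>)" by simp
    have "(norm (ys - xt))\<^sup>2 = s\<^sup>2 * (norm (zs - xt))\<^sup>2"
      unfolding ys_def shift by (simp add: power_mult_distrib)
    also have "\<dots> \<le> s\<^sup>2 * D\<^sup>2" by (rule mult_left_mono[OF D2(1)]) simp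
    finally have "w i * (norm (ys - xt))\<^sup>2 \<le> M * (s\<^sup>2 * D\<^sup>2)"
      using w[OF that] wpos[OF that] M by (intro mult_mono) auto
    also have "\<dots> = s * (s * (M * D\<^sup>2))" by (simp add: power2_eq_square)
    also have "\<dots> \<le> s * \<delta>" using s by (intro mult_left_mono) auto
    finally have "lin i ys + w i * (norm (ys - xt))\<^sup>2 / 2 \<le> - (s * \<delta> / 2)" using 1 by simp
    then have "w i * G i ys \<le> - (s * \<delta> / 2)"
      using wpos[OF that] by (simp add: G_def distrib_left)
    then have "G i ys \<le> - (s * \<delta> / 2) / w i"
      using wpos[OF that] by (subst pos_le_divide_eq) (simp_all add: mult.commute)
    also have "\<dots> \<le> - (s * \<delta> / 2) / M"
      using w[OF that] wpos[OF that] s slater M by (simp add: frac_le)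
    finally show ?thesis by (simp add: \<sigma>')
  qed
  have feas: "G i xn \<le> 0" if "i < m" for i
    using sol that G_iff[OF that, of xn] by (simp add: subprob_sol_def)
  have opt: "\<phi> xn \<le> \<phi> y" if "\<And>i. i < m \<Longrightarrow> G i y \<le> 0" for y
    using sol that G_iff[of _ y] by (simp add: subprob_sol_def \<phi>_def)
  obtain \<mu> where \<mu>: "0 \<le> \<mu>" "\<mu> \<le> (\<phi> ys - \<phi> xn) / \<sigma>"
    and lag: "\<And>z r. (\<And>i. i < m \<Longrightarrow> G i z \<le> r) \<Longrightarrow>
       \<phi> xn + (Lf + \<mu>) / 2 * (norm (z - xn))\<^sup>2 \<le> \<phi> z + \<mu> * r"
    using strongly_convex_multiplier[of \<phi> Lf "{..<m}" G xn ys \<sigma>] \<phi>_comb G_comb feas opt G_ys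
      \<open>0 < \<sigma>\<close> Lf by auto
  have f_below: "gradf xt \<bullet> (z - xt) \<le> f z - f xt" for z
    using convex_on_above_gradient[OF f_conv f_grad, of xt z] by simp
  have \<phi>_xn: "f xn + P1 xn - f xt - L * (norm (xn - xt))\<^sup>2 \<le> \<phi> xn"
  proof -
    have "0 \<le> Lf / 2 * (norm (xn - xt))\<^sup>2" using Lf by simp
    then show ?thesis
      using convex_descent[OF f_conv f_grad f_lip, of xn xt] by (simp add: \<phi>_def)
  qed
  have "\<phi> ys \<le> (1 - s) * \<phi> xt + s * \<phi> zs"
  proof -
    have "0 \<le> s * (1 - s) * (Lf / 2 * (norm (xt - zs))\<^sup>2)" using s Lf by auto
    then show ?thesis using \<phi>_comb[of s xt zs] s by (simp add: ys_def)
  qed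
  \<comment> \<open>The same bound holds at both end points, so the weights disappear. The term
    \<open>- f xt\<close> is kept because it cancels against the one in
    \<open>\<phi>_xn\<close>.\<close>
  also have "\<dots> \<le> (1 - s) * (U + M / 2 * D\<^sup>2 - f xt) + s * (U + M / 2 * D\<^sup>2 - f xt)"
  proof (intro add_mono mult_left_mono)
    have 1: "0 \<le> M / 2 * D\<^sup>2" using M by simp
    then show "\<phi> xt \<le> U + M / 2 * D\<^sup>2 - f xt" using U by (simp add: \<phi>_def)
    have "Lf / 2 * (norm (zs - xt))\<^sup>2 \<le> M / 2 * D\<^sup>2"
      using Lf M D2 by (intro mult_mono) auto
    then show "\<phi> zs \<le> U + M / 2 * D\<^sup>2 - f xt" using U f_below[of zs] by (simp add: \<phi>_def)
  qed (use s in auto)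
  also have "\<dots> = U + M / 2 * D\<^sup>2 - f xt" by (simp only: distrib_right[symmetric]) simp
  finally have "\<phi> ys \<le> U + M / 2 * D\<^sup>2 - f xt" .
  moreover have "L * (norm (xn - xt))\<^sup>2 \<le> L * D\<^sup>2" using D2 \<open>0 \<le> L\<close> by (intro mult_left_mono)
  ultimately have "\<phi> ys - \<phi> xn \<le> U + M / 2 * D\<^sup>2 - lo + L * D\<^sup>2"
    using \<phi>_xn lo by linarith
  then have "(\<phi> ys - \<phi> xn) / \<sigma> \<le> (U + M / 2 * D\<^sup>2 - lo + L * D\<^sup>2) / \<sigma>"
    using \<open>0 < \<sigma>\<close> by (intro divide_right_mono) auto
  then have A: "Ll \<le> Lf + \<mu>" "Lf + \<mu> \<le> M + (U + M / 2 * D\<^sup>2 - lo + L * D\<^sup>2) / \<sigma>"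
    using Lf \<mu> by linarith+
  have "f xn + P1 xn - (f z + P1 z)
      \<le> (Lf + \<mu>) / 2 * ((norm (z - xt))\<^sup>2 - (norm (z - xn))\<^sup>2) + L * (norm (xn - xt))\<^sup>2"
    if z: "\<forall>i<m. g i z \<le> 0" for z
  proof -
    \<comment> \<open>Using the multiplier at this level makes \<open>Lf + \<mu>\<close> the
      coefficient of both squared distances.\<close>
    have "G i z \<le> (norm (z - xt))\<^sup>2 / 2" if "i < m" for i
    proof -
      have "lin i z / w i \<le> 0"
        using lin_le[OF that, of z] z that wpos[OF that] by (intro divide_nonpos_pos) force+
      then show ?thesis unfolding G_def by linarith
    qed
    then have "\<phi> xn + (Lf + \<mu>) / 2 * (norm (z - xn))\<^sup>2 \<le> \<phi> z + \<mu> * ((norm (z - xt))\<^sup>2 / 2)"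
      by (rule lag)
    moreover have "\<phi> z \<le> f z - f xt + Lf / 2 * (norm (z - xt))\<^sup>2 + P1 z"
      using f_below[of z] by (simp add: \<phi>_def)
    ultimately show ?thesis using \<phi>_xn by (simp add: field_simps)
  qed
  then show ?thesis using A by blast
qed

section \<open>Subdifferentials and the error bound implied by the KL inequality\<close>

text \<open>Comparing the proximal point \<open>y\<close> with points of the segment towards
  \<open>z\<close> costs only a second-order term in the step, so the limit leaves the subgradient
  inequality on \<open>C\<close>.\<close>

lemma prox_subgradient:
  fixes h :: "'a::real_inner \<Rightarrow> real"
  assumes "convex C" and conv: "convex_on C h" and "0 < \<mu>" and C: "y \<in> C" "z \<in> C"
    and min: "\<And>u. u \<in> C \<Longrightarrow>
      h y + (norm (y - x))\<^sup>2 / (2 * \<mu>) \<le> h u + (norm (u - x))\<^sup>2 / (2 * \<mu>)"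
  shows "h y + ((x - y) /\<^sub>R \<mu>) \<bullet> (z - y) \<le> h z"
proof -
  have v: "((x - y) /\<^sub>R \<mu>) \<bullet> (z - y) = (x - y) \<bullet> (z - y) / \<mu>"
    by (simp add: divide_inverse mult.commute)
  have "h y + ((x - y) /\<^sub>R \<mu>) \<bullet> (z - y) \<le> h z + s * ((norm (y - z))\<^sup>2 / (2 * \<mu>))"
    if s: "0 < s" "s < 1" for s
  proof -
    let ?u = "(1 - s) *\<^sub>R y + s *\<^sub>R z"
    have "?u \<in> C" using \<open>convex C\<close> C s by (simp add: convex_alt)
    then have "h y + (norm (y - x))\<^sup>2 / (2 * \<mu>) \<le> h ?u + (norm (?u - x))\<^sup>2 / (2 * \<mu>)" by (rule min)
    moreover have "h ?u \<le> (1 - s) * h y + s * h z"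
      using convex_onD[OF conv _ _ C] s by simp
    moreover have "(norm (?u - x))\<^sup>2 =
        (norm (y - x))\<^sup>2 - 2 * s * ((x - y) \<bullet> (z - y)) + s\<^sup>2 * (norm (y - z))\<^sup>2"
      unfolding power2_norm_eq_inner
      by (simp add: inner_left_distrib inner_right_distrib inner_diff_left inner_diff_right
          inner_commute algebra_simps power2_eq_square)
    ultimately have "h y \<le> (1 - s) * h y + s * h z +
        (s\<^sup>2 * (norm (y - z))\<^sup>2 - 2 * s * ((x - y) \<bullet> (z - y))) / (2 * \<mu>)"
      by (simp add: add_divide_distrib diff_divide_distrib)
    also have "\<dots> = h y - s * h y + s * h z + s * (s * ((norm (y - z))\<^sup>2 / (2 * \<mu>)) -
        ((x - y) /\<^sub>R \<mu>) \<bullet> (z - y))"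
      using \<open>0 < \<mu>\<close> unfolding v by (simp add: field_simps power2_eq_square)
    finally have "s * (h y + ((x - y) /\<^sub>R \<mu>) \<bullet> (z - y)) \<le> s * (h z + s * ((norm (y - z))\<^sup>2 / (2 * \<mu>)))"
      by (simp add: algebra_simps)
    then show ?thesis using s by simp
  qed
  then show ?thesis by (rule le_if_le_add_small_mult)
qed

text \<open>The KL hypothesis is accessed through this inclusion: an explicit global subgradient
  shows that the subdifferential is nonempty, and its norm bounds the distance from 0 to it.
  Constant sequences are the witnesses.\<close>

lemma limiting_subdiff_if_subgradient:
  fixes h :: "'a::real_inner \<Rightarrow> ereal"
  assumes "\<bar>h y\<bar> \<noteq> \<infinity>" and "\<And>z. h y + ereal (v \<bullet> (z - y)) \<le> h z"
  shows "v \<in> limiting_subdiff h y"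
proof -
  have "h y + ereal (v \<bullet> (z - y) - e * norm (z - y)) \<le> h z" if "0 < e" for e z
  proof -
    have "h y + ereal (v \<bullet> (z - y) - e * norm (z - y)) \<le> h y + ereal (v \<bullet> (z - y))"
      using that by (intro add_left_mono) simp
    then show ?thesis using assms(2)[of z] by (rule order_trans)
  qed
  then have "v \<in> frechet_subdiff h y"
    using assms(1) by (auto simp: frechet_subdiff_def intro: exI[of _ 1])
  then show ?thesis
    unfolding limiting_subdiff_def
    by (intro CollectI exI[of _ "\<lambda>_. y"] exI[of _ "\<lambda>_. v"]) auto
qed

text \<open>With \<open>P2\<close> zero, this removes the freedom in the choice of
  \<open>\<xi>\<close> from the algorithm.\<close>

lemma limiting_subdiff_const:
  fixes v :: "'a::real_inner"
  assumes "v \<in> limiting_subdiff (\<lambda>_. ereal a) x"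
  shows "v = 0"
proof -
  have zero: "u = 0" if u: "u \<in> frechet_subdiff (\<lambda>_. ereal a) y" for u y :: 'a
  proof (rule ccontr)
    assume "u \<noteq> 0"
    then have "0 < norm u / 2" by simp
    moreover have "\<forall>e>0. \<exists>d>0. \<forall>z. norm (z - y) < d \<longrightarrow> u \<bullet> (z - y) - e * norm (z - y) \<le> 0"
      using u by (simp add: frechet_subdiff_def)
    ultimately obtain d where "0 < d" and
      d: "\<And>z. norm (z - y) < d \<Longrightarrow> u \<bullet> (z - y) - norm u / 2 * norm (z - y) \<le> 0"
      by blast
    \<comment> \<open>A move of length \<open>d / 2\<close> along \<open>u\<close> itself makes the
      linear term exceed the allowed error.\<close>
    define s where "s = d / (2 * norm u)"
    have "0 < s" "s * norm u < d" using \<open>u \<noteq> 0\<close> \<open>0 < d\<close> by (simp_all add: s_def)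
    then have "s * (norm u)\<^sup>2 - norm u / 2 * (s * norm u) \<le> 0"
      using d[of "y + s *\<^sub>R u"] by (simp add: power2_norm_eq_inner)
    then have "s * (norm u)\<^sup>2 \<le> 0" by (simp add: power2_eq_square)
    then show False using \<open>0 < s\<close> \<open>u \<noteq> 0\<close> by (simp add: mult_le_0_iff)
  qed
  obtain vs where "vs \<longlonglongrightarrow> v" "\<And>k. vs k = 0"
    using assms zero unfolding limiting_subdiff_def by blast
  then have "vs = (\<lambda>_. 0)" by auto
  with \<open>vs \<longlonglongrightarrow> v\<close> show ?thesis by (metis LIMSEQ_unique tendsto_const)
qed

text \<open>The KL inequality forces the proximal step of length parameter
  \<open>\<mu> \<sim> r powr (1 - 2 * \<alpha>)\<close> to halve the residual \<open>r\<close>: otherwise the subgradient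
  \<open>(x - y) / \<mu>\<close> at the new point \<open>y\<close> would be so large that the residual drops by \<open>r / 2\<close> anyway.\<close>
lemma KL_prox_halving:
  fixes h :: "'a::euclidean_space \<Rightarrow> real"
  assumes "closed C" "convex C" and conv: "convex_on C h" and cont: "continuous_on C h"
    and bdd: "\<And>r. bounded {z \<in> C. h z \<le> r}"
    and "xs \<in> C" and min: "\<And>z. z \<in> C \<Longrightarrow> h xs \<le> h z" and \<alpha>: "0 \<le> \<alpha>" "\<alpha> < 1"
    and KL: "KL_at (\<lambda>z. if z \<in> C then ereal (h z) else \<infinity>) \<alpha> xs"
  obtains B \<rho> \<epsilon> where "0 < B" "0 < \<rho>" "0 < \<epsilon>"
    "\<And>x. x \<in> C \<Longrightarrow> norm (x - xs) < \<rho> \<Longrightarrow> h xs < h x \<Longrightarrow> h x - h xs < \<epsilon> \<Longrightarrow>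
      B * (h x - h xs) powr (1 - \<alpha>) < \<rho> \<Longrightarrow>
      \<exists>y\<in>C. h y \<le> h x \<and> h y - h xs \<le> (h x - h xs) / 2 \<and>
        norm (x - y) \<le> B * (h x - h xs) powr (1 - \<alpha>)"
proof -
  define H where "H = (\<lambda>z. if z \<in> C then ereal (h z) else \<infinity>)"
  obtain a V a0 where "(0::ereal) < a" "open V" "xs \<in> V" "0 < a0"
    and KL': "\<And>x. x \<in> V \<Longrightarrow> H xs < H x \<Longrightarrow> H x < H xs + a \<Longrightarrow> limiting_subdiff H x \<noteq> {} \<Longrightarrow>
      1 \<le> a0 * (1 - \<alpha>) * (real_of_ereal (H x - H xs)) powr (- \<alpha>)
        * infdist 0 (limiting_subdiff H x)"
    using KL unfolding KL_at_def H_def[symmetric] by blast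
  \<comment> \<open>The KL range \<open>a\<close> may be infinite, so a positive real below it is
    fixed.\<close>
  obtain \<epsilon> where \<epsilon>: "0 < \<epsilon>" "ereal \<epsilon> < a"
    using ereal_dense2[OF \<open>0 < a\<close>] by auto
  obtain R where "0 < R" and R: "ball xs R \<subseteq> V"
    using \<open>open V\<close> \<open>xs \<in> V\<close> by (auto simp: open_contains_ball)
  define b where "b = a0 * (1 - \<alpha>)"
  have "0 < b" using \<open>0 < a0\<close> \<alpha> by (simp add: b_def)
  \<comment> \<open>Every global subgradient \<open>v\<close> on \<open>C\<close> inherits the KL
    lower bound, since the distance from 0 to the subdifferential is at most
    \<open>norm v\<close>.\<close>
  have steep: "(h y - h xs) powr \<alpha> \<le> b * norm v"
    if "y \<in> C" "norm (y - xs) < R" "h xs < h y" "h y - h xs < \<epsilon>"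
      and v: "\<And>z. z \<in> C \<Longrightarrow> h y + v \<bullet> (z - y) \<le> h z" for y v
  proof -
    have "v \<in> limiting_subdiff H y"
      by (rule limiting_subdiff_if_subgradient) (use that in \<open>auto simp: H_def\<close>)
    then have "infdist 0 (limiting_subdiff H y) \<le> norm v" "limiting_subdiff H y \<noteq> {}"
      using infdist_le[of v _ 0] by auto
    moreover have "y \<in> V" using that R by (auto simp: dist_norm norm_minus_commute)
    moreover have "H xs < H y" using that \<open>xs \<in> C\<close> by (simp add: H_def)
    moreover have "H y < H xs + a"
    proof -
      have "H y < H xs + ereal \<epsilon>" using that \<open>xs \<in> C\<close> by (simp add: H_def)
      also have "\<dots> \<le> H xs + a" using \<epsilon> by (intro add_left_mono) simp
      finally show ?thesis .
    qed
    ultimately have "1 \<le> b * (h y - h xs) powr (- \<alpha>) * infdist 0 (limiting_subdiff H y)"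
      using KL'[of y] \<open>y \<in> C\<close> \<open>xs \<in> C\<close> by (simp add: b_def H_def)
    also have "\<dots> \<le> b * (h y - h xs) powr (- \<alpha>) * norm v"
      using \<open>infdist _ _ \<le> _\<close> \<open>0 < b\<close> by (intro mult_left_mono) auto
    finally show ?thesis using that by (simp add: powr_minus field_simps)
  qed
  define B where "B = b * 2 powr \<alpha>"
  show thesis
  proof
    \<comment> \<open>The offset of \<open>x\<close> and the proximal step each use less than
      \<open>R / 2\<close>, so \<open>y\<close> stays in the ball where KL holds.\<close>
    show "0 < B" "0 < R / 2" "0 < \<epsilon>" using \<open>0 < b\<close> \<open>0 < R\<close> \<epsilon> by (simp_all add: B_def)
    fix x assume x: "x \<in> C" "norm (x - xs) < R / 2" "h xs < h x" "h x - h xs < \<epsilon>"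
      and small: "B * (h x - h xs) powr (1 - \<alpha>) < R / 2"
    define r where "r = h x - h xs"
    \<comment> \<open>\<open>p\<close> is the least norm KL allows for a subgradient while the
      residual exceeds \<open>r / 2\<close>. The parameter \<open>\<mu>\<close> is tuned so that
      \<open>\<mu> * p\<^sup>2 = r / 2\<close>, the decrease guaranteed by a subgradient of that
      norm.\<close>
    define p where "p = (r / 2) powr \<alpha> / b"
    define \<mu> where "\<mu> = r / (2 * p\<^sup>2)"
    have "0 < r" using x by (simp add: r_def)
    then have "0 < p" using \<open>0 < b\<close> by (simp add: p_def)
    then have "0 < \<mu>" using \<open>0 < r\<close> by (simp add: \<mu>_def)
    have rp: "r / p = B * r powr (1 - \<alpha>)"
      using \<open>0 < r\<close> \<open>0 < b\<close> by (simp add: p_def B_def powr_divide powr_diff)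
    define K where "K = {z \<in> C. h z \<le> h x}"
    have "compact K"
      unfolding K_def compact_eq_bounded_closed using bdd \<open>closed C\<close> cont
      by (auto intro!: continuous_on_closed_Collect_le continuous_intros)
    moreover have "x \<in> K" using x by (simp add: K_def)
    moreover have "continuous_on K (\<lambda>u. h u + (norm (u - x))\<^sup>2 / (2 * \<mu>))"
      using continuous_on_subset[OF cont, of K] \<open>0 < \<mu>\<close>
      by (auto intro!: continuous_intros simp: K_def)
    ultimately obtain y where "y \<in> K" and y: "\<And>u. u \<in> K \<Longrightarrow>
        h y + (norm (y - x))\<^sup>2 / (2 * \<mu>) \<le> h u + (norm (u - x))\<^sup>2 / (2 * \<mu>)"
      using continuous_attains_inf[of K] by blast
    have "y \<in> C" "h y \<le> h x" using \<open>y \<in> K\<close> by (auto simp: K_def)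
    define v where "v = (x - y) /\<^sub>R \<mu>"
    \<comment> \<open>Minimality over the compact \<open>K\<close> extends to \<open>C\<close>,
      because outside \<open>K\<close> already \<open>h\<close> exceeds its value at
      \<open>x\<close>.\<close>
    have v: "h y + v \<bullet> (z - y) \<le> h z" if "z \<in> C" for z
      unfolding v_def
    proof (rule prox_subgradient[OF \<open>convex C\<close> conv \<open>0 < \<mu>\<close> \<open>y \<in> C\<close> that])
      fix u assume "u \<in> C"
      show "h y + (norm (y - x))\<^sup>2 / (2 * \<mu>) \<le> h u + (norm (u - x))\<^sup>2 / (2 * \<mu>)"
      proof (cases "u \<in> K")
        case False
        then have "h x < h u" using \<open>u \<in> C\<close> by (simp add: K_def)
        then show ?thesis using y[OF \<open>x \<in> K\<close>] \<open>0 < \<mu>\<close>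
          by (smt (verit) divide_nonneg_pos zero_le_power2 norm_zero right_minus_eq zero_power2
              div_0)
      qed (rule y)
    qed
    have dec: "(norm (x - y))\<^sup>2 / \<mu> \<le> h x - h y"
      using v[OF x(1)] by (simp add: v_def power2_norm_eq_inner divide_inverse mult.commute)
    have nv: "norm v = norm (x - y) / \<mu>"
      using \<open>0 < \<mu>\<close> by (simp add: v_def divide_inverse mult.commute)
    have half: "h y - h xs \<le> r / 2" if near: "norm (x - y) \<le> r / p"
    proof (rule ccontr)
      assume *: "\<not> h y - h xs \<le> r / 2"
      have "norm (x - y) < R / 2" using near small rp by (simp add: r_def)
      moreover have "norm (y - xs) \<le> norm (x - y) + norm (x - xs)"
        using norm_triangle_ineq[of "y - x" "x - xs"] by (simp add: norm_minus_commute)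
      ultimately have "norm (y - xs) < R" using x(2) by linarith
      then have "(h y - h xs) powr \<alpha> \<le> b * norm v"
        using * \<open>0 < r\<close> \<open>h y \<le> h x\<close> x v \<open>y \<in> C\<close> by (intro steep) (auto simp: r_def)
      moreover have "(r / 2) powr \<alpha> \<le> (h y - h xs) powr \<alpha>"
        using * \<open>0 < r\<close> \<alpha> by (intro powr_mono2) auto
      ultimately have "p \<le> norm v" using \<open>0 < b\<close> by (simp add: p_def field_simps)
      then have "\<mu> * p\<^sup>2 \<le> \<mu> * (norm v)\<^sup>2"
        using \<open>0 < p\<close> \<open>0 < \<mu>\<close> by (intro mult_left_mono power_mono) auto
      also have "\<dots> = (norm (x - y))\<^sup>2 / \<mu>"
        using \<open>0 < \<mu>\<close> by (simp add: nv power_divide power2_eq_square)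
      also have "\<dots> \<le> h x - h y" by (rule dec)
      finally have "\<mu> * p\<^sup>2 \<le> h x - h y" .
      moreover have "\<mu> * p\<^sup>2 = r / 2" using \<open>0 < p\<close> by (simp add: \<mu>_def)
      ultimately show False using * by (simp add: r_def)
    qed
    have "(norm (x - y))\<^sup>2 \<le> \<mu> * (h x - h y)"
      using dec \<open>0 < \<mu>\<close> by (simp add: field_simps)
    \<comment> \<open>The slack factor 2 makes the right-hand side exactly
      \<open>(r / p)\<^sup>2\<close>.\<close>
    also have "\<dots> \<le> 2 * \<mu> * r"
      using min[OF \<open>y \<in> C\<close>] \<open>0 < \<mu>\<close> \<open>0 < r\<close> by (simp add: r_def mult_left_mono)
    also have "\<dots> = (r / p)\<^sup>2"
      by (simp add: \<mu>_def power2_eq_square)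
    finally have near: "norm (x - y) \<le> r / p"
      by (rule power2_le_imp_le) (use \<open>0 < r\<close> \<open>0 < p\<close> in simp)
    show "\<exists>y\<in>C. h y \<le> h x \<and> h y - h xs \<le> (h x - h xs) / 2 \<and>
        norm (x - y) \<le> B * (h x - h xs) powr (1 - \<alpha>)"
      using \<open>y \<in> C\<close> \<open>h y \<le> h x\<close> half[OF near] near[unfolded rp] by (auto simp: r_def)
  qed
qed

text \<open>Instead of iterating the halving step and summing a geometric series, minimize the
  penalized function \<open>K * r u powr \<beta> + norm (u - x)\<close> over a sublevel set. At a
  minimizer with positive residual one halving step would lower it further, so the residual vanishes
  there, and comparison with \<open>x\<close> gives the distance.\<close>

lemma KL_error_bound:
  fixes h :: "'a::euclidean_space \<Rightarrow> real"
  assumes C: "closed C" "convex C" and conv: "convex_on C h" and cont: "continuous_on C h"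
    and bdd: "\<And>r. bounded {z \<in> C. h z \<le> r}"
    and xs: "xs \<in> C" and min: "\<And>z. z \<in> C \<Longrightarrow> h xs \<le> h z"
    and \<alpha>: "0 \<le> \<alpha>" "\<alpha> < 1"
    and KL: "KL_at (\<lambda>z. if z \<in> C then ereal (h z) else \<infinity>) \<alpha> xs"
  obtains K \<rho> \<epsilon> where "0 < K" "0 < \<rho>" "0 < \<epsilon>"
    "\<And>x. x \<in> C \<Longrightarrow> norm (x - xs) < \<rho> \<Longrightarrow> h x - h xs < \<epsilon> \<Longrightarrow>
      \<exists>z\<in>C. h z = h xs \<and> norm (z - x) \<le> K * (h x - h xs) powr (1 - \<alpha>)"
proof -
  obtain B \<rho> \<epsilon> where pos: "0 < B" "0 < \<rho>" "0 < \<epsilon>" and halving: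
    "\<And>x. x \<in> C \<Longrightarrow> norm (x - xs) < \<rho> \<Longrightarrow> h xs < h x \<Longrightarrow> h x - h xs < \<epsilon> \<Longrightarrow>
      B * (h x - h xs) powr (1 - \<alpha>) < \<rho> \<Longrightarrow>
      \<exists>y\<in>C. h y \<le> h x \<and> h y - h xs \<le> (h x - h xs) / 2 \<and>
        norm (x - y) \<le> B * (h x - h xs) powr (1 - \<alpha>)"
    using KL_prox_halving[OF C conv cont bdd xs min \<alpha> KL] by metis
  define \<beta> where "\<beta> = 1 - \<alpha>"
  have \<beta>: "0 < \<beta>" using \<alpha> by (simp add: \<beta>_def)
  define q :: real where "q = (1 / 2) powr \<beta>"
  have q: "0 < q" "q < 1"
    using \<beta> powr_less_mono2[of \<beta> "1/2" 1] by (auto simp: q_def)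
  \<comment> \<open>Halving multiplies the penalty by at most \<open>q\<close> and costs distance at
    rate \<open>B\<close>; this \<open>K\<close> gives \<open>q * K + B < K\<close>, hence a strict
    net gain.\<close>
  define K where "K = (B + 1) / (1 - q)"
  have "0 < K" using q pos by (simp add: K_def)
  moreover have "(1 - q) * K = B + 1" using q by (simp add: K_def)
  then have "K - q * K = B + 1" by (simp add: left_diff_distrib)
  moreover have "0 < q * K" using q \<open>0 < K\<close> by simp
  ultimately have K: "0 < K" "B \<le> K" "q * K + B < K" by linarith+
  \<comment> \<open>The second bound gives \<open>K * r x powr \<beta> < \<rho> / 2\<close>, which
    keeps the penalized minimizer within \<open>\<rho>\<close> of \<open>xs\<close>.\<close>
  define \<epsilon>' where "\<epsilon>' = min \<epsilon> ((\<rho> / (2 * K)) powr (1 / \<beta>))"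
  show thesis
  proof
    show "0 < K" "0 < \<rho> / 2" "0 < \<epsilon>'" using K pos by (auto simp: \<epsilon>'_def)
    fix x assume x: "x \<in> C" "norm (x - xs) < \<rho> / 2" "h x - h xs < \<epsilon>'"
    define r where "r u = h u - h xs" for u
    have r_nonneg: "0 \<le> r u" if "u \<in> C" for u using min[OF that] by (simp add: r_def)
    have "r x powr \<beta> < ((\<rho> / (2 * K)) powr (1 / \<beta>)) powr \<beta>"
      using x \<beta> r_nonneg[OF x(1)] by (intro powr_less_mono2) (auto simp: r_def \<epsilon>'_def)
    then have small: "K * r x powr \<beta> < \<rho> / 2"
      using \<beta> K pos by (simp add: powr_powr field_simps)
    define S where "S = {z \<in> C. h z \<le> h x}"
    have "compact S"
      unfolding S_def compact_eq_bounded_closed using bdd C cont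
      by (auto intro!: continuous_on_closed_Collect_le continuous_intros)
    moreover have "x \<in> S" using x by (simp add: S_def)
    moreover have "continuous_on S (\<lambda>u. K * r u powr \<beta> + norm (u - x))"
      unfolding r_def using continuous_on_subset[OF cont, of S] min \<beta>
      by (auto intro!: continuous_intros continuous_on_powr' simp: S_def)
    ultimately obtain y where "y \<in> S" and y: "\<And>u. u \<in> S \<Longrightarrow>
        K * r y powr \<beta> + norm (y - x) \<le> K * r u powr \<beta> + norm (u - x)"
      using continuous_attains_inf[of S "\<lambda>u. K * r u powr \<beta> + norm (u - x)"] by blast
    have yC: "y \<in> C" "h y \<le> h x" using \<open>y \<in> S\<close> by (auto simp: S_def)
    have dist: "K * r y powr \<beta> + norm (y - x) \<le> K * r x powr \<beta>" using y[OF \<open>x \<in> S\<close>] by simp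
    have "r y = 0"
    proof (rule ccontr)
      assume "r y \<noteq> 0"
      then have "0 < r y" using r_nonneg[OF yC(1)] by simp
      have "0 \<le> K * r y powr \<beta>" using K by simp
      moreover have "norm (y - xs) \<le> norm (y - x) + norm (x - xs)"
        using norm_triangle_ineq[of "y - x" "x - xs"] by simp
      ultimately have "norm (y - xs) < \<rho>" using dist small x(2) by simp
      moreover have "B * r y powr \<beta> \<le> K * r y powr \<beta>" using K by (intro mult_right_mono) auto
      then have "B * r y powr \<beta> < \<rho>"
        using dist small pos norm_ge_zero[of "y - x"] by linarith
      ultimately obtain z where z: "z \<in> C" "h z \<le> h y" "r z \<le> r y / 2"
          "norm (y - z) \<le> B * r y powr \<beta>"
        using halving[OF yC(1)] \<open>0 < r y\<close> yC x(3) by (auto simp: r_def \<beta>_def \<epsilon>'_def)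
      have "K * r z powr \<beta> \<le> K * (r y / 2) powr \<beta>"
        using z r_nonneg[OF z(1)] K \<beta> by (intro mult_left_mono powr_mono2) auto
      also have "\<dots> = q * K * r y powr \<beta>"
        using \<open>0 < r y\<close> powr_mult[of "r y" "1/2" \<beta>] by (simp add: q_def)
      finally have "K * r z powr \<beta> + norm (z - x) \<le> (q * K + B) * r y powr \<beta> + norm (y - x)"
        using z(4) norm_triangle_ineq[of "z - y" "y - x"]
        by (simp add: algebra_simps norm_minus_commute)
      also have "\<dots> < K * r y powr \<beta> + norm (y - x)"
        using K \<open>0 < r y\<close> by (intro add_strict_right_mono mult_strict_right_mono) auto
      finally show False using y[of z] z yC by (simp add: S_def)
    qed
    then show "\<exists>z\<in>C. h z = h xs \<and> norm (z - x) \<le> K * (h x - h xs) powr (1 - \<alpha>)"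
      using yC dist by (intro bexI[of _ y]) (auto simp: r_def \<beta>_def)
  qed
qed

section \<open>Iterates and quasi-Fejer convergence\<close>

text \<open>By the descent inequalities, a trial can fail only while the parameter to be raised is
  below \<open>2 * L + c\<close>. Hence the powers of \<open>\<tau>\<close> never exceed a bound
  \<open>T\<close> independent of the iteration, and all accepted parameters lie between
  \<open>Ll\<close> and \<open>T * Lu\<close>.\<close>

lemma SCP_ls_accepted_step:
  fixes f P1 :: "'a::real_inner \<Rightarrow> real" and x :: "nat \<Rightarrow> 'a"
  assumes alg: "SCP_ls f gradf P1 (\<lambda>_. 0) g gradg m c Ll Lu \<tau> x"
    and f_descent: "\<And>y z. f y \<le> f z + gradf z \<bullet> (y - z) + L * (norm (y - z))\<^sup>2"
    and g_descent: "\<And>i y z. i < m \<Longrightarrow> g i y \<le> g i z + gradg i z \<bullet> (y - z) + L * (norm (y - z))\<^sup>2"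
    and "0 \<le> L" "0 < c" "0 < Ll" "1 < \<tau>"
  obtains M where "\<And>t i. i < m \<Longrightarrow> g i (x t) \<le> 0"
    "\<And>t. f (x (Suc t)) + P1 (x (Suc t))
      \<le> f (x t) + P1 (x t) - c / 2 * (norm (x (Suc t) - x t))\<^sup>2"
    "\<And>t. \<exists>Lf w. Ll \<le> Lf \<and> Lf \<le> M \<and> (\<forall>i<m. Ll \<le> w i \<and> w i \<le> M) \<and>
      subprob_sol gradf P1 g gradg m (x t) 0 Lf w (x (Suc t))"
proof -
  define T where "T = max 1 (\<tau> * ((2 * L + c) / Ll))"
  have raise: "\<tau> ^ Suc k \<le> T" if "\<tau> ^ k * a < 2 * L + c" "Ll \<le> a" for k a
  proof -
    have "\<tau> ^ k * Ll \<le> \<tau> ^ k * a" using that \<open>1 < \<tau>\<close> by (intro mult_left_mono) auto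
    then have "\<tau> ^ k \<le> (2 * L + c) / Ll" using that \<open>0 < Ll\<close> by (simp add: field_simps)
    then have "\<tau> ^ Suc k \<le> \<tau> * ((2 * L + c) / Ll)"
      unfolding power_Suc using \<open>1 < \<tau>\<close> by (intro mult_left_mono) auto
    then show ?thesis by (simp add: T_def)
  qed
  have step: "(\<forall>i<m. g i (x (Suc t)) \<le> 0) \<and>
      f (x (Suc t)) + P1 (x (Suc t)) \<le> f (x t) + P1 (x t) - c / 2 * (norm (x (Suc t) - x t))\<^sup>2 \<and>
      (\<exists>Lf w. Ll \<le> Lf \<and> Lf \<le> T * Lu \<and> (\<forall>i<m. Ll \<le> w i \<and> w i \<le> T * Lu) \<and>
        subprob_sol gradf P1 g gradg m (x t) 0 Lf w (x (Suc t)))"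
    if xt: "\<And>i. i < m \<Longrightarrow> g i (x t) \<le> 0" for t
  proof -
    obtain \<xi> Lf0 Lg0 K kf kg y where "\<xi> \<in> limiting_subdiff (\<lambda>_. ereal 0) (x t)"
      and Lf0: "Ll \<le> Lf0" "Lf0 \<le> Lu" and Lg0: "\<forall>i<m. Ll \<le> Lg0 i \<and> Lg0 i \<le> Lu"
      and k0: "kf 0 = (0::nat)" "kg 0 = (0::nat)"
      and sol': "\<forall>j\<le>K. subprob_sol gradf P1 g gradg m (x t) \<xi> (\<tau> ^ kf j * Lf0)
                      (\<lambda>i. \<tau> ^ kg j * Lg0 i) (y j)"
      and fail: "\<forall>j<K. if (\<forall>i<m. g i (y j) \<le> 0)
                   then (f (y j) + P1 (y j) - 0
                          > f (x t) + P1 (x t) - 0 - c / 2 * (norm (y j - x t))\<^sup>2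
                         \<and> kf (Suc j) = Suc (kf j) \<and> kg (Suc j) = kg j)
                   else (kf (Suc j) = kf j \<and> kg (Suc j) = Suc (kg j))"
      and acc: "\<forall>i<m. g i (y K) \<le> 0"
        "f (y K) + P1 (y K) - 0 \<le> f (x t) + P1 (x t) - 0 - c / 2 * (norm (y K - x t))\<^sup>2"
        "x (Suc t) = y K"
      using alg[unfolded SCP_ls_def, THEN conjunct2, THEN spec, of t]
      by (elim bexE exE conjE) (rule that; assumption)
    have "\<xi> = 0" by (rule limiting_subdiff_const) fact
    have sol: "subprob_sol gradf P1 g gradg m (x t) 0 (\<tau> ^ kf j * Lf0) (\<lambda>i. \<tau> ^ kg j * Lg0 i) (y j)"
      if "j \<le> K" for j
      using sol' that by (simp add: \<open>\<xi> = 0\<close>)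
    have "\<tau> ^ kf j \<le> T \<and> \<tau> ^ kg j \<le> T" if "j \<le> K" for j
      using that
    proof (induction j)
      case 0
      then show ?case by (simp add: k0 T_def)
    next
      case (Suc j)
      then have IH: "\<tau> ^ kf j \<le> T" "\<tau> ^ kg j \<le> T" and "j < K" by auto
      have sol_j: "subprob_sol gradf P1 g gradg m (x t) 0 (\<tau> ^ kf j * Lf0)
          (\<lambda>i. \<tau> ^ kg j * Lg0 i) (y j)"
        using sol \<open>j < K\<close> by simp
      let ?n = "(norm (y j - x t))\<^sup>2"
      show ?case
      proof (cases "\<forall>i<m. g i (y j) \<le> 0")
        case True
        then have inc: "f (x t) + P1 (x t) - c / 2 * ?n < f (y j) + P1 (y j)"
          and k: "kf (Suc j) = Suc (kf j)" "kg (Suc j) = kg j"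
          using fail \<open>j < K\<close> by auto
        \<comment> \<open>The current iterate is itself feasible for the subproblem, with model
          value \<open>P1 (x t)\<close>.\<close>
        have "gradf (x t) \<bullet> (y j - x t) + \<tau> ^ kf j * Lf0 / 2 * ?n + P1 (y j) \<le> P1 (x t)"
          using sol_j[unfolded subprob_sol_def, THEN conjunct2, rule_format, of "x t"] xt by simp
        then have "\<tau> ^ kf j * Lf0 / 2 * ?n < (L + c / 2) * ?n"
          using inc f_descent[of "y j" "x t"] by (simp add: algebra_simps)
        then have "\<tau> ^ kf j * Lf0 / 2 < L + c / 2"
          by (rule mult_right_less_imp_less) simp
        then have "\<tau> ^ Suc (kf j) \<le> T" by (intro raise[OF _ Lf0(1)]) simp
        then show ?thesis using IH k by simp
      next
        case False
        \<comment> \<open>All constraint parameters share one exponent, so a single violated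
          constraint bounds it.\<close>
        then obtain i where i: "i < m" "0 < g i (y j)" by (auto simp: not_le)
        have k: "kf (Suc j) = kf j" "kg (Suc j) = Suc (kg j)" using fail \<open>j < K\<close> False by auto
        have "g i (x t) + gradg i (x t) \<bullet> (y j - x t) + \<tau> ^ kg j * Lg0 i / 2 * ?n \<le> 0"
          using sol_j i by (simp add: subprob_sol_def)
        then have "\<tau> ^ kg j * Lg0 i / 2 * ?n < L * ?n"
          using i g_descent[OF i(1), of "y j" "x t"] by simp
        then have "\<tau> ^ kg j * Lg0 i / 2 < L"
          by (rule mult_right_less_imp_less) simp
        then have "\<tau> ^ Suc (kg j) \<le> T"
          using Lg0 i \<open>0 < c\<close> by (intro raise[of _ "Lg0 i"]) auto
        then show ?thesis using IH k by simp
      qed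
    qed
    then have K: "\<tau> ^ kf K \<le> T" "\<tau> ^ kg K \<le> T" by auto
    have lower: "Ll \<le> \<tau> ^ k * a" and upper: "\<tau> ^ k \<le> T \<Longrightarrow> \<tau> ^ k * a \<le> T * Lu"
      if "Ll \<le> a" "a \<le> Lu" for k a
    proof -
      have "1 * Ll \<le> \<tau> ^ k * a"
        using that \<open>1 < \<tau>\<close> \<open>0 < Ll\<close> by (intro mult_mono) auto
      then show "Ll \<le> \<tau> ^ k * a" by simp
      show "\<tau> ^ k * a \<le> T * Lu" if "\<tau> ^ k \<le> T"
        using that \<open>Ll \<le> a\<close> \<open>a \<le> Lu\<close> \<open>0 < Ll\<close> by (intro mult_mono) (auto simp: T_def)
    qed
    have "subprob_sol gradf P1 g gradg m (x t) 0 (\<tau> ^ kf K * Lf0)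
        (\<lambda>i. \<tau> ^ kg K * Lg0 i) (x (Suc t))"
      using sol acc by simp
    then show ?thesis
      using acc lower[OF Lf0] upper[OF Lf0 K(1)] lower upper[OF _ _ K(2)] Lg0
      by (intro conjI exI[of _ "\<tau> ^ kf K * Lf0"] exI[of _ "\<lambda>i. \<tau> ^ kg K * Lg0 i"]) auto
  qed
  have feas: "\<forall>i<m. g i (x t) \<le> 0" for t
    by (induction t) (use alg step in \<open>auto simp: SCP_ls_def\<close>)
  show thesis by (rule that[of "T * Lu"]) (use feas step in blast)+
qed

text \<open>For each minimizer \<open>z\<close>, adding \<open>\<kappa> * F (x t)\<close> to the
  squared distance absorbs the error term, so distances to minimizers converge. The three-point
  inequality then drives the values to the minimum, and a cluster point is a minimizer whose
  distance to the iterates tends to 0. Here \<open>x0\<close> is a minimizer, not the starting point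
  \<open>x 0\<close>.\<close>

lemma quasi_fejer_convergence:
  fixes x :: "nat \<Rightarrow> 'a::euclidean_space" and F :: "'a \<Rightarrow> real"
  assumes "closed C" and cont: "continuous_on C F" and xC: "\<And>t. x t \<in> C"
    and bdd: "bounded (range x)" and pos: "0 < c" "0 < l" "0 \<le> L"
    and dec: "\<And>t. F (x (Suc t)) \<le> F (x t) - c / 2 * (norm (x (Suc t) - x t))\<^sup>2"
    and three_point: "\<And>t. \<exists>A. l \<le> A \<and> A \<le> M \<and> (\<forall>z\<in>C. F (x (Suc t)) - F z
      \<le> A / 2 * ((norm (z - x t))\<^sup>2 - (norm (z - x (Suc t)))\<^sup>2) + L * (norm (x (Suc t) - x t))\<^sup>2)"
    and opt: "x0 \<in> C" "\<And>z. z \<in> C \<Longrightarrow> F x0 \<le> F z"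
  obtains xs where "xs \<in> C" "x \<longlonglongrightarrow> xs" "F xs = F x0" "(\<lambda>t. F (x t)) \<longlonglongrightarrow> F xs"
    "\<And>z t. z \<in> C \<Longrightarrow> F z = F xs \<Longrightarrow>
      (norm (z - xs))\<^sup>2 \<le> (norm (z - x t))\<^sup>2 + 4 * L / (l * c) * (F (x t) - F xs)"
proof -
  define \<kappa> where "\<kappa> = 4 * L / (l * c)"
  have "0 \<le> \<kappa>" using pos by (simp add: \<kappa>_def)
  define V where "V z t = (norm (z - x t))\<^sup>2 + \<kappa> * F (x t)" for z t
  have sq: "(norm (x (Suc t) - x t))\<^sup>2 \<le> 2 / c * (F (x t) - F (x (Suc t)))" for t
    using dec[of t] pos by (simp add: field_simps)
  have V_dec: "V z (Suc t) \<le> V z t" if z: "z \<in> C" "F z = F x0" for z t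
  proof -
    let ?n = "(norm (x (Suc t) - x t))\<^sup>2"
    let ?D = "(norm (z - x (Suc t)))\<^sup>2 - (norm (z - x t))\<^sup>2"
    obtain A where A: "l \<le> A" and "F (x (Suc t)) - F z \<le> A / 2 * (- ?D) + L * ?n"
      using three_point[of t] z by auto
    moreover have "F z \<le> F (x (Suc t))" using opt xC z by simp
    ultimately have AD: "A * ?D \<le> 2 * L * ?n" by (simp add: field_simps)
    have "l * ?D \<le> 2 * L * ?n"
    \<comment> \<open>The modulus \<open>A\<close> changes with \<open>t\<close>; the sign of
      \<open>?D\<close> decides how it is exchanged for the fixed lower bound
      \<open>l\<close>.\<close>
    proof (cases "0 \<le> ?D")
      case True
      then have "l * ?D \<le> A * ?D" using A by (intro mult_right_mono)
      then show ?thesis using AD by linarith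
    next
      case False
      then have "l * ?D \<le> 0" using pos by (simp add: mult_le_0_iff)
      moreover have "0 \<le> 2 * L * ?n" using pos by simp
      ultimately show ?thesis by linarith
    qed
    also have "\<dots> \<le> 2 * L * (2 / c * (F (x t) - F (x (Suc t))))"
      using sq pos by (intro mult_left_mono) auto
    finally have "?D \<le> 2 * L * (2 / c * (F (x t) - F (x (Suc t)))) / l"
      using pos by (simp add: pos_le_divide_eq mult.commute)
    also have "\<dots> = \<kappa> * (F (x t) - F (x (Suc t)))"
      using pos by (simp add: \<kappa>_def field_simps)
    finally show ?thesis by (simp add: V_def right_diff_distrib)
  qed
  have F_dec: "F (x (Suc t)) \<le> F (x t)" for t
    using dec[of t] pos by (smt (verit) mult_nonneg_nonneg zero_le_power2 divide_nonneg_pos)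
  have V_anti: "decseq (V z)" if "z \<in> C" "F z = F x0" for z
    using V_dec[OF that] by (rule decseq_SucI)
  have F_anti: "decseq (\<lambda>t. F (x t))" using F_dec by (rule decseq_SucI)
  have F_conv: "convergent (\<lambda>t. F (x t))"
    using decseq_convergent[OF F_anti, of "F x0"] opt xC by (meson convergentI)
  have V_conv: "convergent (V z)" if "z \<in> C" "F z = F x0" for z
  proof -
    have "\<kappa> * F x0 \<le> V z t" for t
      using opt(2)[OF xC, of t] \<open>0 \<le> \<kappa>\<close> by (simp add: V_def mult_left_mono add_increasing)
    then show ?thesis using decseq_convergent[OF V_anti[OF that], of "\<kappa> * F x0"]
      by (meson convergentI)
  qed
  have D_conv: "convergent (\<lambda>t. (norm (z - x t))\<^sup>2)" if "z \<in> C" "F z = F x0" for z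
  proof -
    have "convergent (\<lambda>t. V z t - \<kappa> * F (x t))"
      by (intro convergent_diff V_conv that convergent_mult convergent_const F_conv)
    then show ?thesis by (simp add: V_def)
  qed
  have diff0: "(\<lambda>t. a t - a (Suc t)) \<longlonglongrightarrow> 0" if a: "convergent a" for a :: "nat \<Rightarrow> real"
  proof -
    obtain b where "a \<longlonglongrightarrow> b" using a by (auto simp: convergent_def)
    then have "(\<lambda>t. a t - a (Suc t)) \<longlonglongrightarrow> b - b" by (intro tendsto_diff LIMSEQ_Suc)
    then show ?thesis by simp
  qed
  have F_lim: "(\<lambda>t. F (x t)) \<longlonglongrightarrow> F x0"
  proof -
    let ?D = "\<lambda>t. (norm (x0 - x t))\<^sup>2 - (norm (x0 - x (Suc t)))\<^sup>2"
    \<comment> \<open>Consecutive differences of the convergent distances and values vanish, and the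
      upper bound \<open>M\<close> on \<open>A\<close> lets them squeeze the residual.\<close>
    have "(\<lambda>t. F (x (Suc t)) - F x0) \<longlonglongrightarrow> 0"
    proof (rule tendsto_sandwich[OF _ _ tendsto_const])
      show "\<forall>\<^sub>F t in sequentially. 0 \<le> F (x (Suc t)) - F x0" using opt xC by simp
      show "\<forall>\<^sub>F t in sequentially. F (x (Suc t)) - F x0 \<le>
          M / 2 * \<bar>?D t\<bar> + L * (2 / c * (F (x t) - F (x (Suc t))))"
      proof (rule always_eventually, rule allI)
        fix t
        obtain A where A: "l \<le> A" "A \<le> M" and "F (x (Suc t)) - F x0
            \<le> A / 2 * ?D t + L * (norm (x (Suc t) - x t))\<^sup>2"
          using three_point[of t] opt by auto
        moreover have "A / 2 * ?D t \<le> A / 2 * \<bar>?D t\<bar>" using A pos by (intro mult_left_mono) auto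
        moreover have "A / 2 * \<bar>?D t\<bar> \<le> M / 2 * \<bar>?D t\<bar>" using A by (intro mult_right_mono) auto
        moreover have "L * (norm (x (Suc t) - x t))\<^sup>2 \<le> L * (2 / c * (F (x t) - F (x (Suc t))))"
          using sq pos by (intro mult_left_mono) auto
        ultimately show "F (x (Suc t)) - F x0 \<le>
          M / 2 * \<bar>?D t\<bar> + L * (2 / c * (F (x t) - F (x (Suc t))))" by linarith
      qed
      have "(\<lambda>t. M / 2 * \<bar>?D t\<bar> + L * (2 / c * (F (x t) - F (x (Suc t)))))
          \<longlonglongrightarrow> M / 2 * \<bar>0\<bar> + L * (2 / c * 0)"
        by (intro tendsto_intros diff0 D_conv F_conv opt refl)
      then show "(\<lambda>t. M / 2 * \<bar>?D t\<bar> + L * (2 / c * (F (x t) - F (x (Suc t))))) \<longlonglongrightarrow> 0" by simp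
    qed
    then have "(\<lambda>t. F (x (Suc t)) - F x0 + F x0) \<longlonglongrightarrow> 0 + F x0" by (intro tendsto_intros)
    then show ?thesis by (simp add: filterlim_sequentially_Suc[of "\<lambda>t. F (x t)"])
  qed
  obtain xs \<sigma> where \<sigma>: "strict_mono \<sigma>" "(x \<circ> \<sigma>) \<longlonglongrightarrow> xs"
    using bounded_imp_convergent_subsequence[OF bdd] by blast
  have "xs \<in> C" using closed_sequentially[OF \<open>closed C\<close>, of "x \<circ> \<sigma>" xs] xC \<sigma> by simp
  have "(\<lambda>k. F ((x \<circ> \<sigma>) k)) \<longlonglongrightarrow> F xs"
    by (rule continuous_on_tendsto_compose[OF cont \<sigma>(2) \<open>xs \<in> C\<close>]) (simp add: xC)
  moreover have "(\<lambda>k. F ((x \<circ> \<sigma>) k)) \<longlonglongrightarrow> F x0"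
    using LIMSEQ_subseq_LIMSEQ[OF F_lim \<sigma>(1)] by (simp add: o_def)
  ultimately have Fxs: "F xs = F x0" by (rule LIMSEQ_unique)
  have "x \<longlonglongrightarrow> xs"
  proof -
    \<comment> \<open>The whole sequence of squared distances to \<open>xs\<close> converges, and
      its limit can be read off along \<open>\<sigma>\<close>.\<close>
    obtain d where d: "(\<lambda>t. (norm (xs - x t))\<^sup>2) \<longlonglongrightarrow> d"
      using D_conv[OF \<open>xs \<in> C\<close> Fxs] by (auto simp: convergent_def)
    have "(\<lambda>k. (norm (xs - (x \<circ> \<sigma>) k))\<^sup>2) \<longlonglongrightarrow> d"
      using LIMSEQ_subseq_LIMSEQ[OF d \<sigma>(1)] by (simp add: o_def)
    moreover have "(\<lambda>k. (norm (xs - (x \<circ> \<sigma>) k))\<^sup>2) \<longlonglongrightarrow> (norm (xs - xs))\<^sup>2"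
      by (intro tendsto_intros \<sigma>)
    ultimately have "d = (norm (xs - xs))\<^sup>2" by (rule LIMSEQ_unique)
    then have "(\<lambda>t. sqrt ((norm (xs - x t))\<^sup>2)) \<longlonglongrightarrow> sqrt d" using d by (intro tendsto_real_sqrt)
    then have "(\<lambda>t. norm (x t - xs)) \<longlonglongrightarrow> 0"
      using \<open>d = _\<close> by (simp add: norm_minus_commute)
    then show ?thesis by (simp add: LIM_zero_iff tendsto_norm_zero_iff)
  qed
  show thesis
  proof (rule that[OF \<open>xs \<in> C\<close> \<open>x \<longlonglongrightarrow> xs\<close> Fxs])
    show "(\<lambda>t. F (x t)) \<longlonglongrightarrow> F xs" using F_lim Fxs by simp
    fix z t assume z: "z \<in> C" "F z = F xs"
    have "V z \<longlonglongrightarrow> (norm (z - xs))\<^sup>2 + \<kappa> * F x0"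
      unfolding V_def by (intro tendsto_intros F_lim \<open>x \<longlonglongrightarrow> xs\<close>)
    then have "(norm (z - xs))\<^sup>2 + \<kappa> * F x0 \<le> V z t"
      using V_anti[OF z(1)] z Fxs by (intro decseq_ge) auto
    then show "(norm (z - xs))\<^sup>2 \<le> (norm (z - x t))\<^sup>2 + 4 * L / (l * c) * (F (x t) - F xs)"
      by (simp add: V_def \<kappa>_def[symmetric] Fxs right_diff_distrib)
  qed
qed

section \<open>Convergence rates\<close>

lemma linear_rate:
  fixes r :: "nat \<Rightarrow> real"
  assumes nonneg: "\<And>t. 0 \<le> r t" and "0 < \<kappa>"
    and dec: "\<And>t. T \<le> t \<Longrightarrow> \<kappa> * r t \<le> r t - r (Suc t)"
  obtains B q where "0 < B" "0 < q" "q < 1" "\<And>t. T \<le> t \<Longrightarrow> r t \<le> B * q ^ t"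
proof -
  \<comment> \<open>The maximum keeps \<open>q\<close> positive when \<open>\<kappa>\<close> is at
    least 1; the summand 1 in \<open>B\<close> covers a vanishing \<open>r T\<close>.\<close>
  define q where "q = max (1 - \<kappa>) (1 / 2)"
  have q: "0 < q" "q < 1" using \<open>0 < \<kappa>\<close> by (auto simp: q_def)
  define B where "B = (r T + 1) / q ^ T"
  have "r t \<le> B * q ^ t" if "T \<le> t" for t
    using that
  proof (induction t rule: dec_induct)
    case base
    show ?case using q by (simp add: B_def)
  next
    case (step t)
    have "r (Suc t) \<le> (1 - \<kappa>) * r t" using dec[OF step(1)] by (simp add: algebra_simps)
    also have "\<dots> \<le> q * r t" using nonneg by (intro mult_right_mono) (auto simp: q_def)
    also have "\<dots> \<le> q * (B * q ^ t)" using step q by (intro mult_left_mono) auto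
    finally show ?case by (simp add: mult_ac)
  qed
  moreover have "0 < B" using q nonneg[of T] by (simp add: B_def)
  ultimately show thesis using that q by blast
qed

text \<open>While \<open>r\<close> is positive, \<open>r t powr (- p)\<close> grows by at least
  \<open>p * \<kappa>\<close> per step, by the Bernoulli-type bound
  \<open>(1 - u) powr (- p) \<ge> 1 + p * u\<close> for the relative decrease. Inverting this linear
  growth gives the rate.\<close>

lemma sublinear_rate:
  fixes r :: "nat \<Rightarrow> real"
  assumes nonneg: "\<And>t. 0 \<le> r t" and anti: "decseq r" and "0 < \<kappa>" "0 < p"
    and dec: "\<And>t. T \<le> t \<Longrightarrow> \<kappa> * r t powr (1 + p) \<le> r t - r (Suc t)"
  obtains B T' where "0 < B" "1 \<le> T'" "\<And>t. T' < t \<Longrightarrow> r t \<le> B * real t powr (- (1 / p))"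
proof -
  have grow: "p * \<kappa> * real (t - T) \<le> r t powr (- p)" if "T \<le> t" "0 < r t" for t
    using that
  proof (induction t rule: dec_induct)
    case base
    show ?case by simp
  next
    case (step t)
    have "0 < r t" using step decseqD[OF anti, of t "Suc t"] by simp
    define u where "u = \<kappa> * r t powr p"
    have "0 < u" using \<open>0 < \<kappa>\<close> \<open>0 < r t\<close> by (simp add: u_def)
    have le: "r (Suc t) \<le> r t * (1 - u)"
      using dec[OF step(1)] \<open>0 < r t\<close> by (simp add: u_def powr_add algebra_simps)
    then have "0 < r t * (1 - u)" using step by simp
    then have "u < 1" using \<open>0 < r t\<close> by (simp add: zero_less_mult_iff)
    have "1 + p * u \<le> exp (p * u)" by (rule exp_ge_add_one_self)
    also have "\<dots> \<le> exp (- p * ln (1 - u))"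
      using ln_le_minus_one[of "1 - u"] \<open>u < 1\<close> \<open>0 < p\<close> mult_left_mono[of u "- ln (1 - u)" p] by simp
    also have "\<dots> = (1 - u) powr (- p)" using \<open>u < 1\<close> by (simp add: powr_def)
    finally have bern: "1 + p * u \<le> (1 - u) powr (- p)" .
    have "r t powr (- p) + p * \<kappa> = r t powr (- p) * (1 + p * u)"
      using \<open>0 < r t\<close> by (simp add: u_def powr_minus field_simps)
    also have "\<dots> \<le> r t powr (- p) * (1 - u) powr (- p)"
      using bern by (intro mult_left_mono) auto
    also have "\<dots> = (r t * (1 - u)) powr (- p)" using \<open>0 < r t\<close> \<open>u < 1\<close> by (simp add: powr_mult)
    also have "\<dots> \<le> r (Suc t) powr (- p)"
      using le step \<open>0 < p\<close> by (intro powr_mono2') auto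
    finally show ?case using step \<open>0 < r t\<close> by (simp add: Suc_diff_le algebra_simps)
  qed
  \<comment> \<open>The half accounts for \<open>t - T \<ge> t / 2\<close> once \<open>t\<close>
    exceeds \<open>2 * T + 1\<close>.\<close>
  define b where "b = p * \<kappa> / 2"
  have "0 < b" using \<open>0 < p\<close> \<open>0 < \<kappa>\<close> by (simp add: b_def)
  have "r t \<le> b powr (- (1 / p)) * real t powr (- (1 / p))" if t: "2 * T + 1 < t" for t
  proof (cases "r t = 0")
    case False
    then have "0 < r t" using nonneg[of t] by simp
    have "b * real t \<le> p * \<kappa> * real (t - T)"
      using t \<open>0 < p\<close> \<open>0 < \<kappa>\<close> by (simp add: b_def of_nat_diff field_simps)
    also have "\<dots> \<le> r t powr (- p)" using grow[of t] \<open>0 < r t\<close> t by simp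
    finally have "(r t powr (- p)) powr (- (1 / p)) \<le> (b * real t) powr (- (1 / p))"
      using \<open>0 < p\<close> \<open>0 < b\<close> t by (intro powr_mono2') auto
    then show ?thesis using \<open>0 < r t\<close> \<open>0 < p\<close> \<open>0 < b\<close> by (simp add: powr_powr powr_mult)
  qed simp
  then show thesis using that[of "b powr (- (1 / p))" "2 * T + 1"] \<open>0 < b\<close> by simp
qed

text \<open>\<open>n\<close> stands for the step length and \<open>d\<close> for the distance to a
  nearby minimizer. Multiplying by \<open>r powr (2 * \<beta> - 1)\<close> makes the mixed term a
  multiple of \<open>n * r powr \<beta>\<close>, which AM-GM splits into a part absorbed on the left
  and a part of order \<open>r - r'\<close>.\<close>

lemma residual_recurrence:
  fixes r r' n d :: real
  assumes r: "0 \<le> r'" "r' \<le> r" "r \<le> 1" and \<beta>: "1 / 2 \<le> \<beta>" and "0 \<le> d" "0 \<le> n" "0 < c" "0 \<le> M" "0 \<le> L"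
    and n: "n\<^sup>2 \<le> 2 / c * (r - r')" and d: "d \<le> K * r powr (1 - \<beta>)"
    and step: "r' \<le> M / 2 * (n * (2 * d + n)) + L * n\<^sup>2"
  shows "r powr (2 * \<beta>) \<le> 2 * ((M * K)\<^sup>2 / c + ((M + 2 * L) / c + 1)) * (r - r')"
proof (cases "r = 0")
  case False
  then have "0 < r" using r by simp
  define \<rho> where "\<rho> = r powr \<beta>"
  define C where "C = (M + 2 * L) / c + 1"
  have "0 \<le> C" using assms by (simp add: C_def)
  have absorb: "a \<le> b + s \<Longrightarrow> b \<le> u / 2 + a / 2 \<Longrightarrow> u \<le> 2 * v \<Longrightarrow> a \<le> 2 * (v + s)"
    for a b s u v :: real by (simp add: field_simps)
  have \<rho>2: "\<rho>\<^sup>2 = r powr (2 * \<beta>)" by (simp add: \<rho>_def power2_eq_square powr_add[symmetric])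
  have "(M / 2 + L) * n\<^sup>2 \<le> (M / 2 + L) * (2 / c * (r - r'))"
    using assms by (intro mult_left_mono) auto
  also have "\<dots> = (M + 2 * L) / c * (r - r')" using \<open>0 < c\<close> by (simp add: field_simps)
  \<comment> \<open>Adding \<open>r - r'\<close> turns the bound on \<open>r'\<close> into one on
    \<open>r\<close>; this is the summand 1 in \<open>C\<close>.\<close>
  finally have "r \<le> M * n * d + C * (r - r')"
    using step by (simp add: C_def algebra_simps power2_eq_square)
  also have "M * n * d \<le> M * n * (K * r powr (1 - \<beta>))"
    using d assms by (intro mult_left_mono) auto
  finally have 1: "r \<le> M * n * (K * r powr (1 - \<beta>)) + C * (r - r')" by simp
  have "r powr (2 * \<beta>) = r powr (2 * \<beta> - 1) * r" using \<open>0 < r\<close> by (simp add: powr_diff)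
  also have "\<dots> \<le> r powr (2 * \<beta> - 1) * (M * n * (K * r powr (1 - \<beta>)) + C * (r - r'))"
    by (rule mult_left_mono[OF 1]) simp
  also have "\<dots> = M * n * K * (r powr (2 * \<beta> - 1) * r powr (1 - \<beta>))
      + r powr (2 * \<beta> - 1) * (C * (r - r'))"
    by (simp add: algebra_simps)
  also have "r powr (2 * \<beta> - 1) * r powr (1 - \<beta>) = \<rho>"
    by (simp add: \<rho>_def powr_add[symmetric])
  also have "r powr (2 * \<beta> - 1) * (C * (r - r')) \<le> 1 * (C * (r - r'))"
    using r \<open>0 < r\<close> \<beta> \<open>0 \<le> C\<close> by (intro mult_right_mono) (auto simp: powr_le1)
  finally have "\<rho>\<^sup>2 \<le> (M * K * n) * \<rho> + C * (r - r')" unfolding \<rho>2 by (simp add: mult_ac)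
  \<comment> \<open>AM-GM on the mixed term.\<close>
  moreover have "0 \<le> (M * K * n - \<rho>)\<^sup>2" by simp
  then have "(M * K * n) * \<rho> \<le> (M * K * n)\<^sup>2 / 2 + \<rho>\<^sup>2 / 2"
    by (simp add: power2_diff)
  moreover have "(M * K * n)\<^sup>2 \<le> (M * K)\<^sup>2 * (2 / c * (r - r'))"
    unfolding power_mult_distrib[of "M * K"] using n by (intro mult_left_mono) auto
  then have "(M * K * n)\<^sup>2 \<le> 2 * ((M * K)\<^sup>2 / c * (r - r'))" by (simp add: algebra_simps)
  ultimately have "\<rho>\<^sup>2 \<le> 2 * ((M * K)\<^sup>2 / c * (r - r') + C * (r - r'))"
    by (rule absorb)
  then show ?thesis unfolding \<rho>2 C_def by (simp add: algebra_simps)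
qed (use r in simp)

text \<open>Both regimes are treated with \<open>\<beta> = max \<alpha> (1 / 2)\<close>. Exponents
  below 1/2 bring no gain here, since the Fejer bound already contributes a term of order
  \<open>r t powr (1 / 2)\<close>. The recurrence gives a rate for \<open>r\<close>, and
  \<open>dist\<close> carries it over to the iterates.\<close>

lemma KL_convergence_rate:
  fixes x :: "nat \<Rightarrow> 'a::real_normed_vector" and r :: "nat \<Rightarrow> real" and zs :: "nat \<Rightarrow> 'a"
  assumes \<alpha>: "0 \<le> \<alpha>" "\<alpha> < 1" and pos: "0 < c" "0 \<le> M" "0 \<le> L" "0 \<le> \<kappa>" "0 < K"
    and r: "\<And>t. 0 \<le> r t" "decseq r" "r \<longlonglongrightarrow> 0"
    and dec: "\<And>t. (norm (x (Suc t) - x t))\<^sup>2 \<le> 2 / c * (r t - r (Suc t))"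
    and near: "\<And>t. T \<le> t \<Longrightarrow> norm (zs t - x t) \<le> K * r t powr (1 - \<alpha>)"
    and three_point: "\<And>t. T \<le> t \<Longrightarrow> \<exists>A. 0 \<le> A \<and> A \<le> M \<and> r (Suc t) \<le>
      A / 2 * ((norm (zs t - x t))\<^sup>2 - (norm (zs t - x (Suc t)))\<^sup>2) + L * (norm (x (Suc t) - x t))\<^sup>2"
    and fejer: "\<And>t. T \<le> t \<Longrightarrow> (norm (zs t - xs))\<^sup>2 \<le> (norm (zs t - x t))\<^sup>2 + \<kappa> * r t"
  shows "\<alpha> \<le> 1/2 \<longrightarrow> (\<exists>c0>0. \<exists>Q1. 0 < Q1 \<and> Q1 < 1 \<and> (\<exists>t0::nat. t0 \<ge> 1 \<and>
           (\<forall>t>t0. norm (x t - xs) \<le> c0 * Q1 ^ t)))"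
    and "1/2 < \<alpha> \<longrightarrow> (\<exists>c0>0. \<exists>t0::nat. t0 \<ge> 1 \<and>
           (\<forall>t>t0. norm (x t - xs) \<le> c0 * real t powr (- ((1 - \<alpha>) / (2 * \<alpha> - 1)))))"
proof -
  define \<beta> where "\<beta> = max \<alpha> (1 / 2)"
  have \<beta>: "1 / 2 \<le> \<beta>" "\<alpha> \<le> \<beta>" "\<beta> < 1" using \<alpha> by (auto simp: \<beta>_def)
  have "\<forall>\<^sub>F t in sequentially. r t < 1" using r(3) by (rule order_tendstoD) simp
  then obtain T0 where T0: "\<And>t. T0 \<le> t \<Longrightarrow> r t < 1" by (auto simp: eventually_sequentially)
  define T1 where "T1 = max 1 (max T T0)"
  have r1: "r t \<le> 1" if "T1 \<le> t" for t using T0[of t] that by (simp add: T1_def)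
  have near': "norm (zs t - x t) \<le> K * r t powr (1 - \<beta>)" if "T1 \<le> t" for t
  proof -
    have "r t powr (1 - \<alpha>) \<le> r t powr (1 - \<beta>)"
      using r1[OF that] r(1)[of t] \<beta> by (intro powr_mono') auto
    then have "K * r t powr (1 - \<alpha>) \<le> K * r t powr (1 - \<beta>)" using pos by (intro mult_left_mono) auto
    then show ?thesis using near[of t] that by (simp add: T1_def)
  qed
  \<comment> \<open>The detour through \<open>zs t\<close> uses the error bound twice, and
    \<open>sqrt \<kappa>\<close> stems from the Fejer inequality.\<close>
  define E where "E = 2 * K + sqrt \<kappa>"
  have "0 < E" using pos by (simp add: E_def add_pos_nonneg)
  have dist: "norm (x t - xs) \<le> E * r t powr (1 - \<beta>)" if "T1 \<le> t" for t
  proof -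
    have "norm (zs t - xs) \<le> sqrt ((norm (zs t - x t))\<^sup>2 + \<kappa> * r t)"
      using fejer[of t] that by (intro real_le_rsqrt) (simp add: T1_def)
    also have "\<dots> \<le> sqrt ((norm (zs t - x t))\<^sup>2) + sqrt (\<kappa> * r t)"
      using pos r by (intro sqrt_add_le_add_sqrt) auto
    also have "\<dots> = norm (zs t - x t) + sqrt \<kappa> * r t powr (1 / 2)"
      using r by (simp add: real_sqrt_mult powr_half_sqrt)
    also have "\<dots> \<le> norm (zs t - x t) + sqrt \<kappa> * r t powr (1 - \<beta>)"
      using r1[OF that] r(1)[of t] \<beta> pos by (intro add_left_mono mult_left_mono powr_mono') auto
    finally have "norm (zs t - xs) \<le> norm (zs t - x t) + sqrt \<kappa> * r t powr (1 - \<beta>)" .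
    moreover have "norm (x t - xs) \<le> norm (zs t - x t) + norm (zs t - xs)"
      using norm_triangle_ineq[of "x t - zs t" "zs t - xs"] by (simp add: norm_minus_commute)
    ultimately show ?thesis using near'[OF that] by (simp add: E_def algebra_simps)
  qed
  define \<theta> where "\<theta> = 1 / (2 * ((M * K)\<^sup>2 / c + ((M + 2 * L) / c + 1)))"
  have "0 < 2 * ((M * K)\<^sup>2 / c + ((M + 2 * L) / c + 1))"
    using pos by (simp add: add_nonneg_pos)
  then have \<theta>: "0 < \<theta>" "1 / \<theta> = 2 * ((M * K)\<^sup>2 / c + ((M + 2 * L) / c + 1))"
    by (simp_all add: \<theta>_def)
  have rec: "\<theta> * r t powr (2 * \<beta>) \<le> r t - r (Suc t)" if "T1 \<le> t" for t
  proof -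
    let ?n = "norm (x (Suc t) - x t)" and ?d = "norm (zs t - x t)"
    have "T \<le> t" using that by (simp add: T1_def)
    obtain A where A: "0 \<le> A" "A \<le> M" and
      le: "r (Suc t) \<le> A / 2 * (?d\<^sup>2 - (norm (zs t - x (Suc t)))\<^sup>2) + L * ?n\<^sup>2"
      using three_point[OF \<open>T \<le> t\<close>] by blast
    let ?e = "norm (zs t - x (Suc t))"
    have "?d - ?e \<le> ?n" "?e \<le> ?d + ?n"
      using norm_triangle_ineq[of "zs t - x (Suc t)" "x (Suc t) - x t"]
        norm_triangle_ineq[of "zs t - x t" "x t - x (Suc t)"] by (auto simp: norm_minus_commute)
    \<comment> \<open>Factoring bounds the difference by \<open>?n * (2 * ?d + ?n)\<close>, which
      ties the residual to the step length.\<close>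
    have "?d\<^sup>2 - ?e\<^sup>2 = (?d - ?e) * (?d + ?e)" by (simp add: power2_eq_square algebra_simps)
    also have "\<dots> \<le> ?n * (?d + ?e)" using \<open>?d - ?e \<le> ?n\<close> by (intro mult_right_mono) auto
    also have "\<dots> \<le> ?n * (2 * ?d + ?n)" using \<open>?e \<le> ?d + ?n\<close> by (intro mult_left_mono) auto
    finally have "A / 2 * (?d\<^sup>2 - ?e\<^sup>2) \<le> A / 2 * (?n * (2 * ?d + ?n))"
      using A by (intro mult_left_mono) auto
    also have "\<dots> \<le> M / 2 * (?n * (2 * ?d + ?n))" using A by (intro mult_right_mono) auto
    finally have "r (Suc t) \<le> M / 2 * (?n * (2 * ?d + ?n)) + L * ?n\<^sup>2" using le by linarith
    then have "r t powr (2 * \<beta>) \<le> 1 / \<theta> * (r t - r (Suc t))"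
      unfolding \<theta>(2) using r decseqD[OF r(2), of t "Suc t"] r1[OF that] pos \<beta> dec near'[OF that]
      by (intro residual_recurrence) auto
    then show ?thesis using \<theta>(1) by (simp add: field_simps)
  qed
  have T1: "1 \<le> T1" by (simp add: T1_def)
  show "\<alpha> \<le> 1/2 \<longrightarrow> (\<exists>c0>0. \<exists>Q1. 0 < Q1 \<and> Q1 < 1 \<and> (\<exists>t0::nat. t0 \<ge> 1 \<and>
           (\<forall>t>t0. norm (x t - xs) \<le> c0 * Q1 ^ t)))"
  proof
    assume "\<alpha> \<le> 1/2"
    then have \<beta>_eq: "\<beta> = 1 / 2" by (simp add: \<beta>_def)
    obtain B q where B: "0 < B" "0 < q" "q < 1" "\<And>t. T1 \<le> t \<Longrightarrow> r t \<le> B * q ^ t"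
      using linear_rate[of r \<theta> T1] r(1) \<theta>(1) rec by (auto simp: \<beta>_eq)
    have "norm (x t - xs) \<le> E * sqrt B * sqrt q ^ t" if "T1 < t" for t
    proof -
      have "norm (x t - xs) \<le> E * sqrt (r t)"
        using dist[of t] that r(1)[of t] by (simp add: \<beta>_eq powr_half_sqrt)
      also have "\<dots> \<le> E * sqrt (B * q ^ t)"
        using B(4)[of t] that \<open>0 < E\<close> by (intro mult_left_mono real_sqrt_le_mono) auto
      finally show ?thesis by (simp add: real_sqrt_mult real_sqrt_power)
    qed
    then show "\<exists>c0>0. \<exists>Q1. 0 < Q1 \<and> Q1 < 1 \<and> (\<exists>t0::nat. t0 \<ge> 1 \<and>
           (\<forall>t>t0. norm (x t - xs) \<le> c0 * Q1 ^ t))"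
      using B \<open>0 < E\<close> T1 by (intro exI[of _ "E * sqrt B"] exI[of _ "sqrt q"] conjI exI[of _ T1]) auto
  qed
  show "1/2 < \<alpha> \<longrightarrow> (\<exists>c0>0. \<exists>t0::nat. t0 \<ge> 1 \<and>
           (\<forall>t>t0. norm (x t - xs) \<le> c0 * real t powr (- ((1 - \<alpha>) / (2 * \<alpha> - 1)))))"
  proof
    assume half: "1/2 < \<alpha>"
    then have \<beta>_eq: "\<beta> = \<alpha>" by (simp add: \<beta>_def)
    define p where "p = 2 * \<alpha> - 1"
    have p: "0 < p" "1 + p = 2 * \<beta>" using half by (auto simp: p_def \<beta>_eq)
    obtain B T' where B: "0 < B" "1 \<le> T'" "\<And>t. T' < t \<Longrightarrow> r t \<le> B * real t powr (- (1 / p))"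
      using sublinear_rate[of r \<theta> p T1] r \<theta>(1) p rec by auto
    have "norm (x t - xs) \<le> E * B powr (1 - \<alpha>) * real t powr (- ((1 - \<alpha>) / p))"
      if "max T1 T' < t" for t
    proof -
      have "norm (x t - xs) \<le> E * r t powr (1 - \<alpha>)" using dist[of t] that by (simp add: \<beta>_eq)
      also have "\<dots> \<le> E * (B * real t powr (- (1 / p))) powr (1 - \<alpha>)"
        using B(3)[of t] that \<open>0 < E\<close> \<alpha> r(1) by (intro mult_left_mono powr_mono2) auto
      also have "\<dots> = E * B powr (1 - \<alpha>) * real t powr (- ((1 - \<alpha>) / p))"
        using B by (simp add: powr_mult powr_powr)
      finally show ?thesis .
    qed
    then show "\<exists>c0>0. \<exists>t0::nat. t0 \<ge> 1 \<and>
           (\<forall>t>t0. norm (x t - xs) \<le> c0 * real t powr (- ((1 - \<alpha>) / (2 * \<alpha> - 1))))"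
      unfolding p_def[symmetric] using B \<open>0 < E\<close> T1
      by (intro exI[of _ "E * B powr (1 - \<alpha>)"] conjI exI[of _ "max T1 T'"]) auto
  qed
qed

section \<open>Convergence of SCP with line search\<close>

text \<open>A short move along \<open>d\<close> lowers the active constraints to first order and
  keeps the inactive ones negative by continuity; finiteness gives a common step and margin.\<close>

lemma slater_point_if_MFCQ:
  fixes g :: "nat \<Rightarrow> 'a::real_inner \<Rightarrow> real"
  assumes feas: "\<And>i. i < m \<Longrightarrow> g i z \<le> 0"
    and d: "\<And>i. i < m \<Longrightarrow> g i z = 0 \<Longrightarrow> gradg i z \<bullet> d < 0"
    and grad: "\<And>i. i < m \<Longrightarrow> (g i has_derivative (\<lambda>h. gradg i z \<bullet> h)) (at z)"
  obtains zs \<delta> where "0 < \<delta>" "\<And>i. i < m \<Longrightarrow> g i zs \<le> - \<delta>"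
proof -
  have neg: "\<forall>\<^sub>F s in at_right 0. g i (z + s *\<^sub>R d) < 0" if i: "i < m" for i
  proof -
    have der: "((\<lambda>s. g i (z + s *\<^sub>R d)) has_derivative (\<lambda>s. gradg i z \<bullet> (s *\<^sub>R d))) (at 0)"
    proof (rule has_derivative_compose[where g = "g i"])
      show "((\<lambda>s. z + s *\<^sub>R d) has_derivative (\<lambda>s. s *\<^sub>R d)) (at 0)"
        by (auto intro!: derivative_eq_intros)
      show "(g i has_derivative (\<bullet>) (gradg i z)) (at (z + 0 *\<^sub>R d))" using grad[OF i] by simp
    qed
    show ?thesis
    proof (cases "g i z = 0")
      case True
      have "((\<lambda>s. g i (z + s *\<^sub>R d)) has_real_derivative (gradg i z \<bullet> d)) (at 0)"
        using der by (rule has_derivative_imp_has_field_derivative) simp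
      then obtain e where "0 < e" "\<And>h. 0 < h \<Longrightarrow> h < e \<Longrightarrow> g i (z + (0 + h) *\<^sub>R d) < g i (z + 0 *\<^sub>R d)"
        using DERIV_neg_dec_right d[OF i True] by blast
      then show ?thesis using True by (auto simp: eventually_at_right_field)
    next
      case False
      then have "g i z < 0" using feas[OF i] by simp
      have "((\<lambda>s. g i (z + s *\<^sub>R d)) \<longlongrightarrow> g i (z + 0 *\<^sub>R d)) (at 0)"
        using has_derivative_continuous[OF der] by (simp add: isCont_def)
      then have "((\<lambda>s. g i (z + s *\<^sub>R d)) \<longlongrightarrow> g i z) (at_right 0)"
        using tendsto_mono[OF at_le[of "{0<..}" UNIV "0::real"]] by simp
      then show ?thesis using \<open>g i z < 0\<close> by (rule order_tendstoD)
    qed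
  qed
  have "\<forall>\<^sub>F s in at_right 0. \<forall>i\<in>{..<m}. g i (z + s *\<^sub>R d) < 0"
    using neg by (intro eventually_ball_finite) auto
  then obtain s :: real where s: "\<And>i. i < m \<Longrightarrow> g i (z + s *\<^sub>R d) < 0"
    using eventually_happens'[of "at_right (0::real)"] by fastforce
  \<comment> \<open>The inserted 1 makes the minimum meaningful when there are no
    constraints.\<close>
  define A where "A = insert 1 ((\<lambda>i. - g i (z + s *\<^sub>R d)) ` {..<m})"
  have "finite A" "A \<noteq> {}" by (auto simp: A_def)
  show thesis
  proof
    show "0 < Min A" using \<open>finite A\<close> s by (subst Min_gr_iff) (auto simp: A_def)
    show "g i (z + s *\<^sub>R d) \<le> - Min A" if "i < m" for i
    proof -
      have "- g i (z + s *\<^sub>R d) \<in> A" using that by (simp add: A_def)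
      from Min_le[OF \<open>finite A\<close> this] show ?thesis by linarith
    qed
  qed
qed

theorem mainTheorem9:
  fixes f P1 P2 :: "'a::euclidean_space \<Rightarrow> real"
    and gradf :: "'a \<Rightarrow> 'a"
    and g :: "nat \<Rightarrow> 'a \<Rightarrow> real" and gradg :: "nat \<Rightarrow> 'a \<Rightarrow> 'a"
    and m :: nat and c Ll Lu \<tau> :: real and x :: "nat \<Rightarrow> 'a"
  assumes f_grad: "\<And>z. (f has_derivative (\<lambda>h. gradf z \<bullet> h)) (at z)"
    and P1_convex: "convex_on UNIV P1" and P1_cont: "continuous_on UNIV P1"
    and P2_convex: "convex_on UNIV P2" and P2_cont: "continuous_on UNIV P2"
    and g_cont: "\<And>i. i < m \<Longrightarrow> continuous_on UNIV (g i)"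
    and feasible_nonempty: "\<exists>z. \<forall>i<m. g i z \<le> 0"
    \<comment> \<open>Assumption A\<close>
    and A1: "\<exists>Lf. \<forall>y z. norm (gradf y - gradf z) \<le> Lf * norm (y - z)"
    and A2_grad: "\<And>i z. i < m \<Longrightarrow> (g i has_derivative (\<lambda>h. gradg i z \<bullet> h)) (at z)"
    and A2_lip: "\<And>i. i < m \<Longrightarrow> \<exists>Lg. \<forall>y z. norm (gradg i y - gradg i z) \<le> Lg * norm (y - z)"
    and A3: "\<And>r::real. bounded {z. Fext f P1 P2 g m z \<le> ereal r}"
    \<comment> \<open>Assumption B (MFCQ)\<close>
    and B: "\<And>z. (\<forall>i<m. g i z \<le> 0) \<Longrightarrow> \<exists>d. \<forall>i<m. g i z = 0 \<longrightarrow> gradg i z \<bullet> d < 0"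
    \<comment> \<open>Assumption E\<close>
    and E_P2: "P2 = (\<lambda>z. 0)" and E_f: "convex_on UNIV f"
    and E_g: "\<And>i. i < m \<Longrightarrow> convex_on UNIV (g i)"
    \<comment> \<open>algorithm parameters and iterates\<close>
    and c_pos: "c > 0" and L_pos: "0 < Ll" and L_lt: "Ll < Lu" and tau: "\<tau> > 1"
    and alg: "SCP_ls f gradf P1 P2 g gradg m c Ll Lu \<tau> x"
  shows "\<exists>xs. x \<longlonglongrightarrow> xs \<and> (\<forall>i<m. g i xs \<le> 0) \<and>
           (\<forall>z. Fext f P1 P2 g m xs \<le> Fext f P1 P2 g m z) \<and>
           (\<forall>\<alpha>::real. 0 \<le> \<alpha> \<and> \<alpha> < 1 \<and> KL_function (Fext f P1 P2 g m) \<alpha> \<longrightarrow>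
              (\<alpha> \<le> 1/2 \<longrightarrow> (\<exists>c0>0. \<exists>Q1. 0 < Q1 \<and> Q1 < 1 \<and> (\<exists>t0::nat. t0 \<ge> 1 \<and>
                  (\<forall>t>t0. norm (x t - xs) \<le> c0 * Q1 ^ t)))) \<and>
              (1/2 < \<alpha> \<longrightarrow> (\<exists>c0>0. \<exists>t0::nat. t0 \<ge> 1 \<and>
                  (\<forall>t>t0. norm (x t - xs) \<le> c0 * real t powr (- ((1 - \<alpha>) / (2 * \<alpha> - 1)))))))"
proof -
  define C where "C = {z. \<forall>i<m. g i z \<le> 0}"
  define F where "F z = f z + P1 z" for z
  have Fext: "Fext f P1 P2 g m = (\<lambda>z. if z \<in> C then ereal (F z) else \<infinity>)"
    by (auto simp: Fext_def C_def F_def E_P2)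

  \<comment> \<open>Common Lipschitz constant and descent inequalities\<close>
  have lip_ge: "norm (v y - v z) \<le> M * norm (y - z)"
    if "\<forall>y z. norm (v y - v z) \<le> L * norm (y - z)" "L \<le> M" for v :: "'a \<Rightarrow> 'a" and L M y z
    using that mult_right_mono[OF \<open>L \<le> M\<close>, of "norm (y - z)"] by (meson norm_ge_zero order_trans)
  obtain Lf where Lf: "\<forall>y z. norm (gradf y - gradf z) \<le> Lf * norm (y - z)" using A1 by blast
  obtain Lg where Lg: "\<And>i. i < m \<Longrightarrow> \<forall>y z. norm (gradg i y - gradg i z) \<le> Lg i * norm (y - z)"
    using A2_lip by metis
  define L where "L = Max (insert 0 (insert Lf (Lg ` {..<m})))"
  have L: "0 \<le> L" "Lf \<le> L" "\<And>i. i < m \<Longrightarrow> Lg i \<le> L" unfolding L_def by (rule Max_ge; simp)+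
  note f_lip = lip_ge[OF Lf L(2)]
  note g_lip = lip_ge[OF Lg L(3)]
  have f_descent: "f y \<le> f z + gradf z \<bullet> (y - z) + L * (norm (y - z))\<^sup>2" for y z
    by (rule convex_descent[OF E_f f_grad f_lip])
  have g_descent: "g i y \<le> g i z + gradg i z \<bullet> (y - z) + L * (norm (y - z))\<^sup>2" if "i < m" for i y z
    using that by (intro convex_descent[OF E_g A2_grad g_lip])

  \<comment> \<open>Closedness and convexity of the feasible set, bounded sublevel sets\<close>
  have f_cont: "continuous_on UNIV f"
    using f_grad has_derivative_continuous continuous_at_imp_continuous_on by blast
  have F_cont: "continuous_on S F" for S
    unfolding F_def by (intro continuous_on_subset[OF continuous_on_add[OF f_cont P1_cont]]) simp
  have C_eq: "C = (\<Inter>i\<in>{..<m}. {z. g i z \<le> 0})" by (auto simp: C_def)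
  have "closed C"
    unfolding C_eq using g_cont by (intro closed_INT ballI closed_Collect_le) auto
  have "convex {z. g i z \<le> 0}" if "i < m" for i
    unfolding convex_alt
  proof (intro ballI allI impI CollectI)
    fix y z u assume yz: "y \<in> {z. g i z \<le> 0}" "z \<in> {z. g i z \<le> 0}" and u: "0 \<le> u \<and> u \<le> (1::real)"
    have "g i ((1 - u) *\<^sub>R y + u *\<^sub>R z) \<le> (1 - u) * g i y + u * g i z"
      using convex_onD[OF E_g[OF that]] u by simp
    also have "\<dots> \<le> 0" using yz u by (simp add: add_nonpos_nonpos mult_nonneg_nonpos)
    finally show "g i ((1 - u) *\<^sub>R y + u *\<^sub>R z) \<le> 0" .
  qed
  then have "convex C" unfolding C_eq by (intro convex_INT) auto
  have F_conv: "convex_on C F"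
    unfolding F_def[abs_def]
    by (rule convex_on_subset[OF convex_on_add[OF E_f P1_convex] _ \<open>convex C\<close>]) simp
  have bdd: "bounded {z \<in> C. F z \<le> r}" for r
  proof (rule bounded_subset[OF A3[of r]])
    show "{z \<in> C. F z \<le> r} \<subseteq> {z. Fext f P1 P2 g m z \<le> ereal r}" by (auto simp: Fext)
  qed

  \<comment> \<open>Accepted steps and existence of a minimizer\<close>
  obtain M where xC': "\<And>t i. i < m \<Longrightarrow> g i (x t) \<le> 0"
    and dec': "\<And>t. f (x (Suc t)) + P1 (x (Suc t))
      \<le> f (x t) + P1 (x t) - c / 2 * (norm (x (Suc t) - x t))\<^sup>2"
    and sol: "\<And>t. \<exists>Lf w. Ll \<le> Lf \<and> Lf \<le> M \<and> (\<forall>i<m. Ll \<le> w i \<and> w i \<le> M) \<and>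
      subprob_sol gradf P1 g gradg m (x t) 0 Lf w (x (Suc t))"
    using SCP_ls_accepted_step[OF alg[unfolded E_P2] f_descent g_descent L(1) c_pos L_pos tau] by metis
  have xC: "x t \<in> C" for t using xC' by (simp add: C_def)
  have dec: "F (x (Suc t)) \<le> F (x t) - c / 2 * (norm (x (Suc t) - x t))\<^sup>2" for t
    using dec' by (simp add: F_def)
  have F_anti: "decseq (\<lambda>t. F (x t))"
  proof (rule decseq_SucI)
    show "F (x (Suc t)) \<le> F (x t)" for t
      using dec[of t] c_pos by (smt (verit) mult_nonneg_nonneg zero_le_power2 divide_nonneg_pos)
  qed
  define K where "K = {z \<in> C. F z \<le> F (x 0)}"
  have xK: "x t \<in> K" for t using xC decseqD[OF F_anti, of 0 t] by (simp add: K_def)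
  have "bounded K" unfolding K_def by (rule bdd)
  have "compact K"
    unfolding K_def compact_eq_bounded_closed using bdd \<open>closed C\<close> F_cont
    by (auto intro!: continuous_on_closed_Collect_le continuous_intros)
  then obtain x0 where "x0 \<in> K" "\<And>z. z \<in> K \<Longrightarrow> F x0 \<le> F z"
    using continuous_attains_inf[of K F] F_cont xK by blast
  then have x0: "x0 \<in> C" "\<And>z. z \<in> C \<Longrightarrow> F x0 \<le> F z"
    unfolding K_def by force+

  \<comment> \<open>Slater point and uniform three-point inequality\<close>
  obtain z0 where z0: "\<forall>i<m. g i z0 \<le> 0" using feasible_nonempty by blast
  then obtain d where "\<forall>i<m. g i z0 = 0 \<longrightarrow> gradg i z0 \<bullet> d < 0" using B by blast
  then obtain zs \<delta> where slater: "0 < \<delta>" "\<And>i. i < m \<Longrightarrow> g i zs \<le> - \<delta>"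
    using slater_point_if_MFCQ[of m g z0 gradg d] z0 A2_grad by metis
  obtain D0 where D0: "\<And>z. z \<in> insert zs K \<Longrightarrow> norm z \<le> D0"
    using \<open>bounded K\<close> bounded_insert[of zs K] unfolding bounded_iff by blast
  define D where "D = 2 * D0 + 1"
  have "0 \<le> D0" using order_trans[OF norm_ge_zero D0[of zs]] by simp
  then have "0 < D" by (simp add: D_def)
  have D: "norm (y - z) \<le> D" if "y \<in> insert zs K" "z \<in> insert zs K" for y z
    using norm_triangle_ineq4[of y z] D0[OF that(1)] D0[OF that(2)] by (simp add: D_def)
  define U where "U = max (F (x 0)) (F zs)"
  \<comment> \<open>Nothing here depends on \<open>t\<close>: \<open>D\<close> bounds distances
    among iterates and \<open>zs\<close>, \<open>U\<close> bounds their values, and the same Slater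
    point serves every subproblem.\<close>
  define Am where "Am = M + (U + M / 2 * D\<^sup>2 - F x0 + L * D\<^sup>2) / (min 1 (\<delta> / (M * D\<^sup>2)) * \<delta> / (2 * M))"
  have three_point: "\<exists>A. Ll \<le> A \<and> A \<le> Am \<and> (\<forall>z\<in>C. F (x (Suc t)) - F z
      \<le> A / 2 * ((norm (z - x t))\<^sup>2 - (norm (z - x (Suc t)))\<^sup>2) + L * (norm (x (Suc t) - x t))\<^sup>2)" for t
  proof -
    obtain Lf' w where *: "Ll \<le> Lf'" "Lf' \<le> M" "\<forall>i<m. Ll \<le> w i \<and> w i \<le> M"
      "subprob_sol gradf P1 g gradg m (x t) 0 Lf' w (x (Suc t))" using sol[of t] by blast
    have "f (x t) + P1 (x t) \<le> U" "f zs + P1 zs \<le> U"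
      using decseqD[OF F_anti, of 0 t] by (auto simp: U_def F_def)
    moreover have "F x0 \<le> f (x (Suc t)) + P1 (x (Suc t))"
      using x0(2)[OF xC, of "Suc t"] by (simp add: F_def)
    ultimately show ?thesis
      using subprob_three_point[OF E_f f_grad f_lip L(1) P1_convex E_g A2_grad *(4) L_pos *(1,2) _
          xC' slater(2,1) D D \<open>0 < D\<close> _ _ _ refl, of U "F x0"] *(3) xK
      by (simp add: C_def F_def Am_def)
  qed

  \<comment> \<open>Convergence of the iterates\<close>
  have "bounded (range x)" using \<open>bounded K\<close> xK by (auto intro: bounded_subset)
  obtain xs where "xs \<in> C" "x \<longlonglongrightarrow> xs" and Fxs: "F xs = F x0"
    and F_lim: "(\<lambda>t. F (x t)) \<longlonglongrightarrow> F xs"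
    and fejer: "\<And>z t. z \<in> C \<Longrightarrow> F z = F xs \<Longrightarrow>
      (norm (z - xs))\<^sup>2 \<le> (norm (z - x t))\<^sup>2 + 4 * L / (Ll * c) * (F (x t) - F xs)"
    using quasi_fejer_convergence[OF \<open>closed C\<close> F_cont xC \<open>bounded (range x)\<close> c_pos L_pos L(1) dec
        three_point x0] by metis
  have min: "F xs \<le> F z" if "z \<in> C" for z using x0(2)[OF that] Fxs by simp

  \<comment> \<open>Rates under the KL property\<close>
  have rate: "(\<alpha> \<le> 1/2 \<longrightarrow> (\<exists>c0>0. \<exists>Q1. 0 < Q1 \<and> Q1 < 1 \<and> (\<exists>t0::nat. t0 \<ge> 1 \<and>
                  (\<forall>t>t0. norm (x t - xs) \<le> c0 * Q1 ^ t)))) \<and>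
              (1/2 < \<alpha> \<longrightarrow> (\<exists>c0>0. \<exists>t0::nat. t0 \<ge> 1 \<and>
                  (\<forall>t>t0. norm (x t - xs) \<le> c0 * real t powr (- ((1 - \<alpha>) / (2 * \<alpha> - 1))))))"
    if \<alpha>: "0 \<le> \<alpha>" "\<alpha> < 1" and KL: "KL_function (Fext f P1 P2 g m) \<alpha>" for \<alpha> :: real
  proof -
    \<comment> \<open>Minimality makes 0 a subgradient at \<open>xs\<close>, so the KL property is
      available at the limit.\<close>
    have "0 \<in> limiting_subdiff (Fext f P1 P2 g m) xs"
      by (rule limiting_subdiff_if_subgradient) (use \<open>xs \<in> C\<close> min in \<open>auto simp: Fext\<close>)
    then have KL_xs: "KL_at (\<lambda>z. if z \<in> C then ereal (F z) else \<infinity>) \<alpha> xs"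
      using KL unfolding KL_function_def Fext by blast
    obtain K \<rho> \<epsilon> where "0 < K" "0 < \<rho>" "0 < \<epsilon>" and eb:
      "\<And>y. y \<in> C \<Longrightarrow> norm (y - xs) < \<rho> \<Longrightarrow> F y - F xs < \<epsilon> \<Longrightarrow>
        \<exists>z\<in>C. F z = F xs \<and> norm (z - y) \<le> K * (F y - F xs) powr (1 - \<alpha>)"
      by (rule KL_error_bound[OF \<open>closed C\<close> \<open>convex C\<close> F_conv F_cont bdd \<open>xs \<in> C\<close> min \<alpha> KL_xs])
        (assumption, (rule that; blast))
    have r_lim: "(\<lambda>t. F (x t) - F xs) \<longlonglongrightarrow> 0" using F_lim by (simp add: LIM_zero)
    have "(\<lambda>t. norm (x t - xs)) \<longlonglongrightarrow> 0"
      using \<open>x \<longlonglongrightarrow> xs\<close> by (simp add: LIM_zero tendsto_norm_zero)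
    then have "\<forall>\<^sub>F t in sequentially. norm (x t - xs) < \<rho> \<and> F (x t) - F xs < \<epsilon>"
      using \<open>0 < \<rho>\<close> \<open>0 < \<epsilon>\<close> r_lim by (intro eventually_conj order_tendstoD)
    then obtain T where "\<And>t. T \<le> t \<Longrightarrow> norm (x t - xs) < \<rho> \<and> F (x t) - F xs < \<epsilon>"
      by (auto simp: eventually_sequentially)
    then have "\<exists>z\<in>C. F z = F xs \<and> norm (z - x t) \<le> K * (F (x t) - F xs) powr (1 - \<alpha>)"
      if "T \<le> t" for t
      using that eb xC by blast
    \<comment> \<open>From here on \<open>zs t\<close> is a minimizer close to \<open>x t\<close>,
      no longer the Slater point.\<close>
    then obtain zs where zs: "\<And>t. T \<le> t \<Longrightarrow> zs t \<in> C" "\<And>t. T \<le> t \<Longrightarrow> F (zs t) = F xs"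
        "\<And>t. T \<le> t \<Longrightarrow> norm (zs t - x t) \<le> K * (F (x t) - F xs) powr (1 - \<alpha>)"
      by metis
    have Am: "0 \<le> Am" using three_point[of 0] L_pos by force
    have tp: "\<exists>A\<ge>0. A \<le> Am \<and> F (x (Suc t)) - F xs \<le>
      A / 2 * ((norm (zs t - x t))\<^sup>2 - (norm (zs t - x (Suc t)))\<^sup>2) + L * (norm (x (Suc t) - x t))\<^sup>2"
      if t: "T \<le> t" for t
    proof -
      obtain A where A: "Ll \<le> A" "A \<le> Am" "\<forall>z\<in>C. F (x (Suc t)) - F z
        \<le> A / 2 * ((norm (z - x t))\<^sup>2 - (norm (z - x (Suc t)))\<^sup>2) + L * (norm (x (Suc t) - x t))\<^sup>2"
        using three_point[of t] by blast
      show ?thesis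
        using A(1,2) A(3)[rule_format, OF zs(1)[OF t]] L_pos
        unfolding zs(2)[OF t] by (intro exI[of _ A]) simp
    qed
    have sq: "(norm (x (Suc t) - x t))\<^sup>2 \<le> 2 / c * (F (x t) - F xs - (F (x (Suc t)) - F xs))" for t
      using dec[of t] c_pos by (simp add: field_simps)
    have r_anti: "decseq (\<lambda>t. F (x t) - F xs)" using F_anti by (simp add: decseq_def)
    have nonneg: "0 \<le> F (x t) - F xs" for t using min xC by simp
    have \<kappa>: "0 \<le> 4 * L / (Ll * c)" using L L_pos c_pos by simp
    have fj: "(norm (zs t - xs))\<^sup>2 \<le> (norm (zs t - x t))\<^sup>2 + 4 * L / (Ll * c) * (F (x t) - F xs)"
      if "T \<le> t" for t
      using that by (intro fejer zs)
    note rates = KL_convergence_rate[where r = "\<lambda>t. F (x t) - F xs" and zs = zs and T = T,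
        OF \<alpha> c_pos Am L(1) \<kappa> \<open>0 < K\<close> nonneg r_anti r_lim sq _ _ fj]
    show ?thesis by (intro conjI rates) (simp_all only: zs(3) tp)
  qed
  have "Fext f P1 P2 g m xs \<le> Fext f P1 P2 g m z" for z
    using min[of z] \<open>xs \<in> C\<close> by (simp add: Fext)
  then show ?thesis using \<open>x \<longlonglongrightarrow> xs\<close> \<open>xs \<in> C\<close> rate unfolding C_def by blast
qed

end
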